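(* Let $(\Omega,\mathcal F,\mathbb P)$ be a complete probability space with an increasing sequence of sub-$\sigma$-algebras $(\mathcal F_n)_{n\ge0}$ such that $\mathcal F=\sigma(\bigcup_n\mathcal F_n)$, let $p(\cdot):\Omega\to(0,\infty)$ be measurable with $0<p_-\le p_+<\infty$, and let $0<q\le\infty$. Then $$H^s_{p(\cdot),q}=H_{p(\cdot),q}^{\mathrm{at},1,\infty}$$ with equivalent quasi-norms.
   Context: $p_-=\operatorname{ess\,inf}_\Omega p$, $p_+=\operatorname{ess\,sup}_\Omega p$; $\|f\|_{p(\cdot)}=\inf\{\lambda>0:\int_\Omega(|f(x)|/\lambda)^{p(x)}d\mathbb P\le1\}$. Variable Lorentz quasi-norm: $\|f\|_{L_{p(\cdot),q}}=\left(\int_0^\infty\lambda^q\|\chi_{\{|f|>\lambda\}}\|_{p(\cdot)}^q\frac{d\lambda}{\lambda}\right)^{1/q}$ for $q<\infty$, $\|f\|_{L_{p(\cdot),\infty}}=\sup_{\lambda>0}\lambda\|\chi_{\{|f|>\lambda\}}\|_{p(\cdot)}$. $\mathbb E_n=\mathbb E(\cdot|\mathcal F_n)$. A martingale is a sequence $f=(f_n)_{n\ge0}\subset L_1(\Omega)$ with $\mathbb E_n(f_{n+1})=f_n$ for every $n\ge0$; $f_{-1}:=0$ and $d_nf=f_n-f_{n-1}$, $n\ge0$. The conditional square function is $s(f)=\left(\sum_{n=0}^\infty\mathbb E_{n-1}|d_nf|^2\right)^{1/2}$ (given in this form, without a stated convention for $\mathbb E_{-1}$); for a function $a$ it is applied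 to the martingale $a_n=\mathbb E_na$. $H^s_{p(\cdot),q}$ is the space of martingales with $\|f\|_{H^s_{p(\cdot),q}}=\|s(f)\|_{L_{p(\cdot),q}}<\infty$. A $(1,p(\cdot),\infty)$-atom is a measurable function $a$ for which there is a stopping time $\tau$ with respect to $(\mathcal F_n)$ (possibly taking the value $\infty$) such that $\mathbb E(a|\mathcal F_n)=0$ for all $n\le\tau$, i.e. on $\{n\le\tau\}$, and $\|s(a)\|_\infty\le1/\|\chi_{\{\tau<\infty\}}\|_{p(\cdot)}$. $H_{p(\cdot),q}^{\mathrm{at},1,\infty}$ is the space of all martingales $f=(f_n)_{n\ge0}$ such that, for all $n\in\mathbb N=\{0,1,2,\dots\}$, $f_n=\sum_{k\in\mathbb Z}\mu_ka^k_n$ a.e., where $(a^k)_{k\in\mathbb Z}$ is a sequence of $(1,p(\cdot),\infty)$-atoms associated with stopping times $(\tau_k)_{k\in\mathbb Z}$, $a^k_n=\mathbb E_na^k$, and $\mu_k=3\cdot2^k\|\chi_{\{\tau_k<\infty\}}\|_{p(\cdot)}$ for each $k$; for such $f$, $$\|f\|_{H_{p(\cdot),q}^{\mathrm{at},1,\infty}}=\inf\left(\sum_{k\in\mathbb Z}2^{kq}\|\chi_{\{\tau_k<\infty\}}\|_{p(\cdot)}^q\right)^{1/q}\approx\inf\|(\mu_k)_{k\in\mathbb Z}\|_{\ell_q}$$ (with the supremum over $k$ of $2^k\|\chi_{\{\tau_k<\infty\}}\|_{p(\cdot)}$ if $q=\infty$), the infimum being taken over all such decompositions of $f$.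
   Formalization: The equality is proved for the martingales of H^s with f_0 = 0 a.e.; without this it fails: every atom has E_0 a = 0, so every f in the atomic space has f_0 = 0 a.e., while the constant martingale f_n = 1 lies in H^s. *)

theory Defs
  imports "HOL-Probability.Probability"
begin

definition enn_powr :: "ennreal \<Rightarrow> real \<Rightarrow> ennreal" where
  "enn_powr x r = (if x = \<infinity> then \<infinity> else ennreal (enn2real x powr r))"
  \<comment> \<open>the power \<open>x\<^sup>r\<close> on \<open>[0,\<infinity>]\<close>, used for \<open>r > 0\<close> only\<close>

definition essinf :: "'a measure \<Rightarrow> ('a \<Rightarrow> ereal) \<Rightarrow> ereal" where
  "essinf M f = Liminf (ae_filter M) f"
  \<comment> \<open>dual to \<^const>\<open>esssup\<close> for measurable functions\<close>

definition var_norm :: "'a measure \<Rightarrow> ('a \<Rightarrow> real) \<Rightarrow> ('a \<Rightarrow> real) \<Rightarrow> ennreal" where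
  "var_norm M p f =
     Inf {ennreal l | l. 0 < l \<and> (\<integral>\<^sup>+x. ennreal ((\<bar>f x\<bar> / l) powr p x) \<partial>M) \<le> 1}"

abbreviation var_norm_set :: "'a measure \<Rightarrow> ('a \<Rightarrow> real) \<Rightarrow> 'a set \<Rightarrow> ennreal" where
  "var_norm_set M p A \<equiv> var_norm M p (indicat_real A)"

text \<open>The argument \<open>g\<close> plays the role of \<open>\<bar>f\<bar>\<close>; it is extended-valued because the conditional
  square function may be infinite. The exponent \<open>q\<close> ranges over \<open>(0,\<infinity>]\<close>.\<close>

definition lorentz_norm :: "'a measure \<Rightarrow> ('a \<Rightarrow> real) \<Rightarrow> ennreal \<Rightarrow> ('a \<Rightarrow> ennreal) \<Rightarrow> ennreal" where
  "lorentz_norm M p q g =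
     (if q = \<infinity> then
        (SUP l\<in>{0::real<..}. ennreal l * var_norm_set M p {x \<in> space M. ennreal l < g x})
      else
        enn_powr
          (\<integral>\<^sup>+l\<in>{0::real<..}. ennreal (l powr enn2real q)
              * enn_powr (var_norm_set M p {x \<in> space M. ennreal l < g x}) (enn2real q)
              * ennreal (1 / l) \<partial>lborel)
          (1 / enn2real q))"

definition martingale :: "'a measure \<Rightarrow> (nat \<Rightarrow> 'a measure) \<Rightarrow> (nat \<Rightarrow> 'a \<Rightarrow> real) \<Rightarrow> bool" where
  "martingale M F f \<longleftrightarrow>
     (\<forall>n. integrable M (f n)) \<and> (\<forall>n. AE x in M. real_cond_exp M (F n) (f (Suc n)) x = f n x)"

definition mdiff :: "(nat \<Rightarrow> 'a \<Rightarrow> real) \<Rightarrow> nat \<Rightarrow> 'a \<Rightarrow> real" where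
  "mdiff f n x = (if n = 0 then f 0 x else f n x - f (n - 1) x)"

text \<open>The convention for the index \<open>-1\<close> is \<open>F\<^sub>-\<^sub>1 = F\<^sub>0\<close>, which is what truncated subtraction
  in \<open>F (n - 1)\<close> gives for \<open>n = 0\<close>.\<close>

definition cond_square :: "'a measure \<Rightarrow> (nat \<Rightarrow> 'a measure) \<Rightarrow> (nat \<Rightarrow> 'a \<Rightarrow> real) \<Rightarrow> 'a \<Rightarrow> ennreal" where
  "cond_square M F f x =
     enn_powr (\<Sum>n. nn_cond_exp M (F (n - 1)) (\<lambda>y. ennreal (\<bar>mdiff f n y\<bar>\<^sup>2)) x) (1 / 2)"

definition Hs_norm ::
  "'a measure \<Rightarrow> (nat \<Rightarrow> 'a measure) \<Rightarrow> ('a \<Rightarrow> real) \<Rightarrow> ennreal \<Rightarrow> (nat \<Rightarrow> 'a \<Rightarrow> real) \<Rightarrow> ennreal" where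
  "Hs_norm M F p q f = lorentz_norm M p q (cond_square M F f)"

definition Hs ::
  "'a measure \<Rightarrow> (nat \<Rightarrow> 'a measure) \<Rightarrow> ('a \<Rightarrow> real) \<Rightarrow> ennreal \<Rightarrow> (nat \<Rightarrow> 'a \<Rightarrow> real) set" where
  "Hs M F p q = {f. martingale M F f \<and> Hs_norm M F p q f < \<infinity>}"

text \<open>To use the library notion for times with values in \<open>{0,1,2,\<dots>,\<infinity>}\<close>, the filtration is
  extended by \<open>M\<close> at index \<open>\<infinity>\<close>; the condition at \<open>\<infinity>\<close> is vacuous.\<close>

definition ext_stopping_time :: "'a measure \<Rightarrow> (nat \<Rightarrow> 'a measure) \<Rightarrow> ('a \<Rightarrow> enat) \<Rightarrow> bool" where
  "ext_stopping_time M F \<tau> \<longleftrightarrow> stopping_time (\<lambda>t. case t of enat n \<Rightarrow> F n | \<infinity> \<Rightarrow> M) \<tau>"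

abbreviation tau_norm :: "'a measure \<Rightarrow> ('a \<Rightarrow> real) \<Rightarrow> ('a \<Rightarrow> enat) \<Rightarrow> ennreal" where
  "tau_norm M p \<tau> \<equiv> var_norm_set M p {x \<in> space M. \<tau> x < \<infinity>}"

text \<open>Integrability of \<open>a\<close> is what makes \<open>E(a | F\<^sub>n)\<close> meaningful. In the last line \<open>1 / 0 = \<infinity>\<close>
  in \<^typ>\<open>ennreal\<close>.\<close>

definition atom ::
  "'a measure \<Rightarrow> (nat \<Rightarrow> 'a measure) \<Rightarrow> ('a \<Rightarrow> real) \<Rightarrow> ('a \<Rightarrow> enat) \<Rightarrow> ('a \<Rightarrow> real) \<Rightarrow> bool" where
  "atom M F p \<tau> a \<longleftrightarrow>
     integrable M a \<and> ext_stopping_time M F \<tau> \<and>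
     (\<forall>n. AE x in M. enat n \<le> \<tau> x \<longrightarrow> real_cond_exp M (F n) a x = 0) \<and>
     esssup M (cond_square M F (\<lambda>n. real_cond_exp M (F n) a)) \<le> 1 / tau_norm M p \<tau>"

definition atomic_decomp ::
  "'a measure \<Rightarrow> (nat \<Rightarrow> 'a measure) \<Rightarrow> ('a \<Rightarrow> real) \<Rightarrow> (nat \<Rightarrow> 'a \<Rightarrow> real) \<Rightarrow>
     (int \<Rightarrow> 'a \<Rightarrow> enat) \<Rightarrow> (int \<Rightarrow> 'a \<Rightarrow> real) \<Rightarrow> bool" where
  "atomic_decomp M F p f \<tau> a \<longleftrightarrow>
     (\<forall>k. atom M F p (\<tau> k) (a k)) \<and>
     (\<forall>n. AE x in M.
        ((\<lambda>k. 3 * 2 powi k * enn2real (tau_norm M p (\<tau> k)) * real_cond_exp M (F n) (a k) x)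
          has_sum f n x) UNIV)"

definition dyadic_norm :: "'a measure \<Rightarrow> ('a \<Rightarrow> real) \<Rightarrow> ennreal \<Rightarrow> (int \<Rightarrow> 'a \<Rightarrow> enat) \<Rightarrow> ennreal" where
  "dyadic_norm M p q \<tau> =
     (if q = \<infinity> then (SUP k. ennreal (2 powi k) * tau_norm M p (\<tau> k))
      else
        enn_powr
          (\<Sum>\<^sub>\<infinity>k. ennreal (2 powr (real_of_int k * enn2real q))
              * enn_powr (tau_norm M p (\<tau> k)) (enn2real q))
          (1 / enn2real q))"

definition Hat_norm ::
  "'a measure \<Rightarrow> (nat \<Rightarrow> 'a measure) \<Rightarrow> ('a \<Rightarrow> real) \<Rightarrow> ennreal \<Rightarrow> (nat \<Rightarrow> 'a \<Rightarrow> real) \<Rightarrow> ennreal" where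
  "Hat_norm M F p q f = Inf {dyadic_norm M p q \<tau> | \<tau> a. atomic_decomp M F p f \<tau> a}"

definition Hat ::
  "'a measure \<Rightarrow> (nat \<Rightarrow> 'a measure) \<Rightarrow> ('a \<Rightarrow> real) \<Rightarrow> ennreal \<Rightarrow> (nat \<Rightarrow> 'a \<Rightarrow> real) set" where
  "Hat M F p q =
     {f. martingale M F f \<and> (\<exists>\<tau> a. atomic_decomp M F p f \<tau> a) \<and> Hat_norm M F p q f < \<infinity>}"

text \<open>Atoms have \<open>E(a | F\<^sub>0) = 0\<close>, since \<open>0 \<le> \<tau>\<close> everywhere. So every martingale with an atomic
  decomposition starts at \<open>0\<close>, whereas \<^const>\<open>Hs\<close> contains for example the constant martingale
  \<open>1\<close>: the two spaces can only be compared on martingales with \<open>f\<^sub>0 = 0\<close> a.e., the usual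
  normalisation for martingale Hardy spaces.\<close>

lemma Hat_start_zero:
  assumes "f \<in> Hat M F p q"
  shows "AE x in M. f 0 x = 0"
proof -
  obtain \<tau> a where d: "atomic_decomp M F p f \<tau> a"
    using assms by (auto simp: Hat_def)
  have "AE x in M. real_cond_exp M (F 0) (a k) x = 0" for k
  proof -
    have "AE x in M. enat 0 \<le> \<tau> k x \<longrightarrow> real_cond_exp M (F 0) (a k) x = 0"
      using d unfolding atomic_decomp_def atom_def by blast
    then show ?thesis by (simp add: zero_enat_def[symmetric])
  qed
  then have "AE x in M. \<forall>k. real_cond_exp M (F 0) (a k) x = 0"
    by (simp add: AE_all_countable)
  moreover have "AE x in M.
      ((\<lambda>k. 3 * 2 powi k * enn2real (tau_norm M p (\<tau> k)) * real_cond_exp M (F 0) (a k) x)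
        has_sum f 0 x) UNIV"
    using d unfolding atomic_decomp_def by blast
  ultimately show ?thesis
  proof eventually_elim
    case (elim x)
    then have "((\<lambda>k::int. 0::real) has_sum f 0 x) UNIV" by simp
    from infsumI[OF this] show ?case by simp
  qed
qed

end

theory Submission
  imports Defs
begin

text \<open>Write \<open>S\<^sub>n = \<Sum>\<^bsub>i\<le>n\<^esub> E\<^bsub>i-1\<^esub>|d\<^sub>i f|\<^sup>2\<close>, so that \<open>s(f)\<^sup>2 = sup S\<^sub>n\<close>, and write \<open>N A\<close> for
  \<open>\<parallel>\<chi>\<^sub>A\<parallel>\<^bsub>p(.)\<^esub>\<close>.  Cutting the integral over \<open>(0,\<infinity>)\<close> at the powers of two shows that the Lorentz
  quasi-norm of \<open>g\<close> is comparable with the \<open>\<ell>\<^sub>q\<close> quasi-norm of the sequence \<open>2\<^sup>k N{g > 2\<^sup>k}\<close>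
  (\<open>lorentz_integral_le_sum\<close>, \<open>lorentz_sum_le_integral\<close>).

  Let \<open>f\<close> be a martingale with \<open>f\<^sub>0 = 0\<close> and \<open>s(f)\<close> in the Lorentz space.  Since \<open>S\<^bsub>n+1\<^esub>\<close> is
  \<open>F\<^sub>n\<close>-measurable, \<open>\<tau>\<^sub>k = inf {n. S\<^bsub>n+1\<^esub> > 4\<^sup>k}\<close> is a stopping time, and \<open>{\<tau>\<^sub>k < \<infinity>} = {s(f) > 2\<^sup>k}\<close>.
  The difference of the martingale stopped at \<open>\<tau>\<^bsub>k+1\<^esub>\<close> and at \<open>\<tau>\<^sub>k\<close> keeps exactly the increments
  \<open>d\<^sub>m f\<close> on the predictable event \<open>{4\<^sup>k < S\<^sub>m \<le> 4\<^bsup>k+1\<^esup>}\<close>; its square function is at most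
  \<open>2\<^bsup>k+1\<^esup>\<close>, hence it is bounded in \<open>L\<^sup>2\<close> and closed by an integrable function
  (\<open>closing_variable\<close>, \<open>predictable_restriction\<close>), which divided by \<open>3 \<cdot> 2\<^sup>k N{\<tau>\<^sub>k < \<infinity>}\<close> is an atom.
  At almost every point each increment with \<open>S\<^sub>m > 0\<close> lies in exactly one band, and increments with
  \<open>S\<^sub>m = 0\<close> vanish, so the atoms sum to \<open>f\<close> and the sums involved are finite
  (\<open>atomic_decomp_exceed_time\<close>).

  Conversely, let \<open>f = \<Sum> \<mu>\<^sub>k a\<^sup>k\<close>.  Where \<open>\<tau>\<^sub>k = \<infinity>\<close> for all \<open>k \<ge> j\<close>, only the atoms with \<open>k < j\<close>
  contribute to the increments of \<open>f\<close>, and a weighted Cauchy-Schwarz inequality together with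
  \<open>s(\<mu>\<^sub>k a\<^sup>k) \<le> 3 \<cdot> 2\<^sup>k\<close> yields \<open>s(f) \<le> 3 \<cdot> 2\<^sup>j\<close> there (\<open>cond_square_le_off_atoms\<close>).  Thus
  \<open>{s(f) > 2\<^bsup>j+2\<^esup>}\<close> is, up to a null set, contained in \<open>\<Union>\<^bsub>k\<ge>j\<^esub> {\<tau>\<^sub>k < \<infinity>}\<close>.  The bound
  \<open>N (\<Union>\<^sub>i A\<^sub>i) \<le> K sup\<^sub>i (3/2)\<^sup>i N A\<^sub>i\<close> (\<open>var_norm_set_UN\<close>) replaces the triangle inequality: as \<open>3/2 < 2\<close>,
  inserting it into the dyadic sum leaves a convergent geometric series, whatever \<open>q\<close> is
  (\<open>lorentz_sum_geometric\<close>).\<close>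

section \<open>Powers and integer sums on the extended half-line\<close>

lemma enn_powr_ennreal [simp]: "0 \<le> a \<Longrightarrow> enn_powr (ennreal a) r = ennreal (a powr r)"
  by (simp add: enn_powr_def)

lemma enn_powr_0 [simp]: "enn_powr 0 r = 0"
  by (simp add: enn_powr_def)

lemma enn_powr_top [simp]: "enn_powr \<top> r = \<top>"
  by (simp add: enn_powr_def)

lemma enn_powr_mono: 
  assumes "0 < r" "x \<le> y" shows "enn_powr x r \<le> enn_powr y r"
  using assms by (cases x; cases y) (auto simp: powr_mono2 top_unique)

lemma enn_powr_mult:
  assumes "0 < r" shows "enn_powr (x * y) r = enn_powr x r * enn_powr y r"
  using assms
  by (cases x; cases y)
    (auto simp: powr_mult ennreal_mult[symmetric] ennreal_mult_top ennreal_top_mult)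

lemma enn_powr_powr:
  assumes "0 < r" "0 < s" shows "enn_powr (enn_powr x r) s = enn_powr x (r * s)"
  using assms by (cases x) (auto simp: powr_powr)

lemma enn_powr_1 [simp]: "enn_powr x 1 = x"
  by (cases x) auto

lemma enn_powr_inverse [simp]:
  assumes "0 < r" shows "enn_powr (enn_powr x r) (1 / r) = x" "enn_powr (enn_powr x (1 / r)) r = x"
  using assms by (simp_all add: enn_powr_powr)

lemma enn_powr_less_iff:
  assumes "0 < r" shows "enn_powr x r < enn_powr y r \<longleftrightarrow> x < y"
  using enn_powr_mono[OF assms, of x y] enn_powr_mono[OF assms, of y x]
    enn_powr_mono[of "1 / r" "enn_powr y r" "enn_powr x r"] assms
  by (auto simp: not_le[symmetric])

lemma enn_powr_eq_top_iff [simp]: "enn_powr x r = \<top> \<longleftrightarrow> x = \<top>"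
  by (cases x) auto

lemma measurable_enn_powr [measurable]:
  assumes [measurable]: "f \<in> borel_measurable N"
  shows "(\<lambda>x. enn_powr (f x) r) \<in> borel_measurable N"
  unfolding enn_powr_def by measurable

lemma infsum_int_eq_nn_integral:
  fixes f :: "int \<Rightarrow> ennreal"
  shows "(\<Sum>\<^sub>\<infinity>k. f k) = (\<integral>\<^sup>+k. f k \<partial>count_space UNIV)"
proof (rule antisym)
  have "sum f I \<le> (\<integral>\<^sup>+k. f k \<partial>count_space UNIV)" if "finite I" for I
  proof -
    have "sum f I = (\<integral>\<^sup>+k. f k \<partial>count_space I)"
      using that by (simp add: nn_integral_count_space_finite)
    also have "\<dots> = (\<integral>\<^sup>+k. f k * indicator I k \<partial>count_space UNIV)"
      by (simp add: nn_integral_count_space_indicator)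
    also have "\<dots> \<le> (\<integral>\<^sup>+k. f k \<partial>count_space UNIV)"
      by (intro nn_integral_mono) (auto simp: indicator_def)
    finally show ?thesis .
  qed
  then show "(\<Sum>\<^sub>\<infinity>k. f k) \<le> (\<integral>\<^sup>+k. f k \<partial>count_space UNIV)"
    by (subst nonneg_infsum_complete) (auto intro!: SUP_least)
next
  let ?b = "from_nat_into (UNIV :: int set)"
  have b: "bij_betw ?b UNIV UNIV"
    by (rule bij_betw_from_nat_into) (auto simp: infinite_UNIV_int)
  have "(\<integral>\<^sup>+k. f k \<partial>count_space UNIV) = (\<integral>\<^sup>+n. f (?b n) \<partial>count_space UNIV)"
    by (rule nn_integral_bij_count_space[OF b, symmetric])
  also have "\<dots> = (\<Sum>n. f (?b n))"
    by (rule nn_integral_count_space_nat)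
  also have "\<dots> = (SUP n. \<Sum>i<n. f (?b i))"
    by (rule suminf_eq_SUP)
  also have "\<dots> \<le> (\<Sum>\<^sub>\<infinity>k. f k)"
  proof (rule SUP_least)
    fix n
    have "(\<Sum>i<n. f (?b i)) = sum f (?b ` {..<n})"
      using b by (subst sum.reindex) (auto simp: bij_betw_def inj_on_def)
    also have "\<dots> \<le> (\<Sum>\<^sub>\<infinity>k. f k)"
      by (subst nonneg_infsum_complete) (auto intro!: SUP_upper)
    finally show "(\<Sum>i<n. f (?b i)) \<le> (\<Sum>\<^sub>\<infinity>k. f k)" .
  qed
  finally show "(\<integral>\<^sup>+k. f k \<partial>count_space UNIV) \<le> (\<Sum>\<^sub>\<infinity>k. f k)" .
qed

lemma nn_integral_infsum_int:
  fixes f :: "int \<Rightarrow> 'a \<Rightarrow> ennreal"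
  assumes "\<And>k. f k \<in> borel_measurable N"
  shows "(\<integral>\<^sup>+x. (\<Sum>\<^sub>\<infinity>k. f k x) \<partial>N) = (\<Sum>\<^sub>\<infinity>k. \<integral>\<^sup>+x. f k x \<partial>N)"
  unfolding infsum_int_eq_nn_integral
  by (rule nn_integral_count_space_nn_integral) (use assms in auto)

lemma infsum_int_cmult:
  fixes f :: "int \<Rightarrow> ennreal"
  shows "(\<Sum>\<^sub>\<infinity>k. c * f k) = c * (\<Sum>\<^sub>\<infinity>k. f k)"
  unfolding infsum_int_eq_nn_integral by (rule nn_integral_cmult) auto

lemma infsum_int_mono:
  fixes f g :: "int \<Rightarrow> ennreal"
  shows "(\<And>k. f k \<le> g k) \<Longrightarrow> (\<Sum>\<^sub>\<infinity>k. f k) \<le> (\<Sum>\<^sub>\<infinity>k. g k)"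
  unfolding infsum_int_eq_nn_integral by (rule nn_integral_mono) auto

lemma infsum_int_shift:
  fixes f :: "int \<Rightarrow> ennreal"
  shows "(\<Sum>\<^sub>\<infinity>k. f (k + m)) = (\<Sum>\<^sub>\<infinity>k. f k)"
  by (rule infsum_reindex_bij_betw[where g = "\<lambda>k. k + m"])
    (auto intro!: bij_betwI[where g = "\<lambda>k. k - m"])

lemma infsum_int_ge_member:
  fixes f :: "int \<Rightarrow> ennreal"
  shows "f k \<le> (\<Sum>\<^sub>\<infinity>k. f k)"
  using nn_integral_ge_point[of k UNIV f] by (simp add: infsum_int_eq_nn_integral)

lemma power_powr_swap: "0 < a \<Longrightarrow> (a ^ i) powr d = (a powr d) ^ i" for a d :: real
  by (simp add: powr_powr powr_power mult.commute flip: powr_realpow)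

text \<open>The Cauchy-Schwarz inequality with weights \<open>2\<^bsup>-i\<^esup>\<close>, whose sum is \<open>2\<close>.\<close>

lemma sums_square_le:
  fixes g :: "nat \<Rightarrow> real"
  assumes "g sums d"
  shows "ennreal (d\<^sup>2) \<le> (\<Sum>i. ennreal (2 * 2 ^ i * (g i)\<^sup>2))"
proof (rule LIMSEQ_le_const2)
  have "(\<lambda>n. \<Sum>i<n. g i) \<longlonglongrightarrow> d"
    using assms by (simp add: sums_def)
  then show "(\<lambda>n. ennreal ((\<Sum>i<n. g i)\<^sup>2)) \<longlonglongrightarrow> ennreal (d\<^sup>2)"
    by (intro tendsto_ennrealI tendsto_power)
  have "ennreal ((\<Sum>i<n. g i)\<^sup>2) \<le> (\<Sum>i. ennreal (2 * 2 ^ i * (g i)\<^sup>2))" for n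
  proof -
    have p: "((1 / sqrt 2) ^ i)\<^sup>2 = (1 / 2) ^ i" "(sqrt 2 ^ i)\<^sup>2 = 2 ^ i" for i
      by (simp_all add: power2_eq_square power_mult_distrib[symmetric])
    have "(1 / sqrt 2) ^ i * sqrt 2 ^ i = 1" for i
      unfolding power_mult_distrib[symmetric] by simp
    then have gi: "g i = (1 / sqrt 2) ^ i * (sqrt 2 ^ i * g i)" for i
      by (simp only: mult.assoc[symmetric])
    have "(\<Sum>i<n. g i)\<^sup>2 = (\<Sum>i<n. (1 / sqrt 2) ^ i * (sqrt 2 ^ i * g i))\<^sup>2"
      by (intro arg_cong[where f = "\<lambda>y. y\<^sup>2"] sum.cong refl gi)
    also have "\<dots> \<le> (\<Sum>i<n. ((1 / sqrt 2) ^ i)\<^sup>2) * (\<Sum>i<n. (sqrt 2 ^ i * g i)\<^sup>2)"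
      by (rule Cauchy_Schwarz_ineq_sum)
    also have "\<dots> = (\<Sum>i<n. (1 / 2) ^ i) * (\<Sum>i<n. 2 ^ i * (g i)\<^sup>2)"
      by (simp only: power_mult_distrib p)
    also have "\<dots> \<le> 2 * (\<Sum>i<n. 2 ^ i * (g i)\<^sup>2)"
      by (intro mult_right_mono sum_nonneg) (auto simp: sum_gp_strict)
    also have "\<dots> = (\<Sum>i<n. 2 * 2 ^ i * (g i)\<^sup>2)"
      by (simp add: sum_distrib_left mult.assoc)
    finally have "ennreal ((\<Sum>i<n. g i)\<^sup>2) \<le> ennreal (\<Sum>i<n. 2 * 2 ^ i * (g i)\<^sup>2)"
      by (rule ennreal_leI)
    also have "\<dots> = (\<Sum>i<n. ennreal (2 * 2 ^ i * (g i)\<^sup>2))"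
      by (intro sum_ennreal[symmetric]) simp
    also have "\<dots> \<le> (\<Sum>i. ennreal (2 * 2 ^ i * (g i)\<^sup>2))"
      by (intro sum_le_suminf summableI) auto
    finally show ?thesis .
  qed
  then show "\<exists>N. \<forall>n\<ge>N. ennreal ((\<Sum>i<n. g i)\<^sup>2) \<le> (\<Sum>i. ennreal (2 * 2 ^ i * (g i)\<^sup>2))"
    by blast
qed

lemma suminf_ennreal_swap:
  fixes f :: "nat \<Rightarrow> nat \<Rightarrow> ennreal"
  shows "(\<Sum>i. \<Sum>j. f i j) = (\<Sum>j. \<Sum>i. f i j)"
  using nn_integral_suminf[of "\<lambda>j i. f i j" "count_space UNIV"]
  by (simp add: nn_integral_count_space_nat)

text \<open>Terms of a series that are kept only while the partial sum through that term is at most \<open>L\<close> add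
  up to at most \<open>L\<close>; the selection \<open>Q\<close> need not be monotone.\<close>

lemma truncated_sum_le:
  fixes c :: "nat \<Rightarrow> ennreal" and Q :: "nat \<Rightarrow> bool"
  assumes "\<And>m. Q m \<Longrightarrow> (\<Sum>i\<le>Suc m. c i) \<le> L"
  shows "(\<Sum>m. if Q m then c (Suc m) else 0) \<le> L"
proof -
  have le: "(\<Sum>m<N. if Q m then c (Suc m) else 0) \<le> (\<Sum>i\<le>N. c i)" for N
  proof (induction N)
    case (Suc N)
    have "(\<Sum>m<Suc N. if Q m then c (Suc m) else 0) \<le> (\<Sum>i\<le>N. c i) + c (Suc N)"
      unfolding sum.lessThan_Suc by (intro add_mono Suc) simp
    then show ?case by simp
  qed simp
  have "(\<Sum>m<N. if Q m then c (Suc m) else 0) \<le> L" for N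
  proof (induction N)
    case (Suc N)
    show ?case
    proof (cases "Q N")
      case True
      have "(\<Sum>m<Suc N. if Q m then c (Suc m) else 0) \<le> (\<Sum>i\<le>N. c i) + c (Suc N)"
        using True le[of N] by (simp add: add_right_mono)
      also have "\<dots> = (\<Sum>i\<le>Suc N. c i)" by simp
      also have "\<dots> \<le> L" by (rule assms[OF True])
      finally show ?thesis .
    qed (use Suc in simp)
  qed simp
  then show ?thesis
    by (intro suminf_le_const summableI)
qed

section \<open>Dyadic discretisation of the Lorentz quasi-norm\<close>

text \<open>The index \<open>k\<close> with \<open>2\<^sup>k < l \<le> 2\<^bsup>k+1\<^esup>\<close>, for \<open>l > 0\<close>.\<close>

definition dyadic_level :: "real \<Rightarrow> int" where
  "dyadic_level l = \<lceil>log 2 l\<rceil> - 1"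

lemma dyadic_level_iff:
  assumes "0 < l"
  shows "2 powi k < l \<and> l \<le> 2 powi (k + 1) \<longleftrightarrow> k = dyadic_level l"
proof -
  have p: "2 powi m = 2 powr real_of_int m" for m :: int
    by (simp add: powr_real_of_int')
  have "2 powi k < l \<longleftrightarrow> real_of_int k < log 2 l"
    unfolding p using assms by (simp add: less_log_iff)
  moreover have "l \<le> 2 powi (k + 1) \<longleftrightarrow> log 2 l \<le> real_of_int (k + 1)"
    unfolding p using assms by (simp add: log_le_iff)
  ultimately show ?thesis
    unfolding dyadic_level_def by linarith
qed

lemma nn_integral_dyadic_step:
  fixes c :: "int \<Rightarrow> ennreal"
  shows "(\<integral>\<^sup>+l\<in>{0<..}. c (dyadic_level l) \<partial>lborel) = (\<Sum>\<^sub>\<infinity>k. c k * ennreal (2 powi k))"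
proof -
  have "c (dyadic_level l) * indicator {0<..} l
      = (\<Sum>\<^sub>\<infinity>k. c k * indicator {2 powi k<..2 powi (k + 1)} l)" for l :: real
  proof (cases "0 < l")
    case True
    have "(\<Sum>\<^sub>\<infinity>k. c k * indicator {2 powi k<..2 powi (k + 1)} l)
        = (\<Sum>\<^sub>\<infinity>k\<in>{dyadic_level l}. c k * indicator {2 powi k<..2 powi (k + 1)} l)"
      using dyadic_level_iff[OF True]
      by (intro infsum_cong_neutral) (auto simp: indicator_def)
    also have "\<dots> = c (dyadic_level l) * indicator {2 powi dyadic_level l<..2 powi (dyadic_level l + 1)} l"
      by (subst infsum_finite, simp, subst sum.insert) auto
    finally show ?thesis
      using True dyadic_level_iff[OF True, of "dyadic_level l"] by (simp add: indicator_def)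
  next
    case False
    have "0 < (2::real) powi k" for k by simp
    then have "indicator {2 powi k<..2 powi (k + 1)} l = (0::ennreal)" for k
      using False less_trans[of 0 "2 powi k" l] by (auto simp: indicator_def)
    then show ?thesis using False by simp
  qed
  then have "(\<integral>\<^sup>+l\<in>{0<..}. c (dyadic_level l) \<partial>lborel)
      = (\<integral>\<^sup>+l. (\<Sum>\<^sub>\<infinity>k. c k * indicator {2 powi k<..2 powi (k + 1)} (l::real)) \<partial>lborel)"
    by simp
  also have "\<dots> = (\<Sum>\<^sub>\<infinity>k. \<integral>\<^sup>+l. c k * indicator {2 powi k<..2 powi (k + 1)} (l::real) \<partial>lborel)"
    by (rule nn_integral_infsum_int) measurable
  also have "\<dots> = (\<Sum>\<^sub>\<infinity>k. c k * ennreal (2 powi k))"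
  proof (rule infsum_cong)
    fix k :: int
    have "(2::real) powi k \<le> 2 powi (k + 1)"
      by (simp add: power_int_add)
    then have "emeasure lborel {(2::real) powi k<..2 powi (k + 1)} = ennreal (2 powi k)"
      by (subst emeasure_lborel_Ioc) (auto simp: power_int_add)
    then show "(\<integral>\<^sup>+l. c k * indicator {2 powi k<..2 powi (k + 1)} (l::real) \<partial>lborel) = c k * ennreal (2 powi k)"
      by (simp add: nn_integral_cmult)
  qed
  finally show ?thesis .
qed

text \<open>The \<open>q\<close>-th power of the Lorentz quasi-norm, for finite \<open>q\<close>, in terms of the function
  \<open>u l = \<parallel>\<chi>{|f| > l}\<parallel>\<close>.\<close>

definition lorentz_integral :: "real \<Rightarrow> (real \<Rightarrow> ennreal) \<Rightarrow> ennreal" where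
  "lorentz_integral q u =
     (\<integral>\<^sup>+l\<in>{0<..}. ennreal (l powr q) * enn_powr (u l) q * ennreal (1 / l) \<partial>lborel)"

text \<open>The dyadic counterpart: the sum of \<open>(2\<^sup>k v\<^sub>k)\<^sup>q\<close> over all integers \<open>k\<close>.\<close>

definition lorentz_sum :: "real \<Rightarrow> (int \<Rightarrow> ennreal) \<Rightarrow> ennreal" where
  "lorentz_sum q v = (\<Sum>\<^sub>\<infinity>k. ennreal (2 powr (real_of_int k * q)) * enn_powr (v k) q)"

lemma powr_powi: "(2 powi k) powr q = 2 powr (real_of_int k * q)"
  by (simp add: powr_real_of_int'[symmetric] powr_powr)

lemma lorentz_integral_le_sum:
  assumes q: "0 < q" and u: "\<And>l m. 0 < l \<Longrightarrow> l \<le> m \<Longrightarrow> u m \<le> u l"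
  shows "lorentz_integral q u \<le> ennreal (2 powr q) * lorentz_sum q (\<lambda>k. u (2 powi k))"
proof -
  define c where "c k = ennreal (2 powr (real_of_int (k + 1) * q)) * enn_powr (u (2 powi k)) q
      * ennreal (1 / 2 powi k)" for k
  have "ennreal (l powr q) * enn_powr (u l) q * ennreal (1 / l) \<le> c (dyadic_level l)" if "0 < l" for l
  proof -
    let ?k = "dyadic_level l"
    have l: "2 powi ?k < l" "l \<le> 2 powi (?k + 1)"
      using dyadic_level_iff[OF that, of ?k] by auto
    have "l powr q \<le> 2 powr (real_of_int (?k + 1) * q)"
      unfolding powr_powi[symmetric] using l that q by (intro powr_mono2) auto
    moreover have "enn_powr (u l) q \<le> enn_powr (u (2 powi ?k)) q"
      using l q by (intro enn_powr_mono u) auto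
    moreover have "1 / l \<le> 1 / 2 powi ?k"
      using l that by (intro divide_left_mono) auto
    ultimately show ?thesis
      unfolding c_def by (intro mult_mono ennreal_leI) auto
  qed
  then have "lorentz_integral q u \<le> (\<integral>\<^sup>+l\<in>{0<..}. c (dyadic_level l) \<partial>lborel)"
    unfolding lorentz_integral_def by (intro nn_integral_mono) (auto simp: indicator_def)
  also have "\<dots> = (\<Sum>\<^sub>\<infinity>k. c k * ennreal (2 powi k))"
    by (rule nn_integral_dyadic_step)
  also have "\<dots> = (\<Sum>\<^sub>\<infinity>k. ennreal (2 powr q)
      * (ennreal (2 powr (real_of_int k * q)) * enn_powr (u (2 powi k)) q))"
  proof (rule infsum_cong)
    fix k :: int
    have "c k * ennreal (2 powi k) = ennreal (2 powr (real_of_int (k + 1) * q))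
        * enn_powr (u (2 powi k)) q * (ennreal (1 / 2 powi k) * ennreal (2 powi k))"
      unfolding c_def by (simp add: mult.assoc)
    also have "ennreal (1 / 2 powi k) * ennreal (2 powi k) = 1"
      by (subst ennreal_mult[symmetric]) auto
    also have "2 powr (real_of_int (k + 1) * q) = 2 powr q * 2 powr (real_of_int k * q)"
      by (simp add: powr_add[symmetric] algebra_simps)
    finally show "c k * ennreal (2 powi k) = ennreal (2 powr q)
      * (ennreal (2 powr (real_of_int k * q)) * enn_powr (u (2 powi k)) q)"
      by (simp add: ennreal_mult mult.assoc)
  qed
  also have "\<dots> = ennreal (2 powr q) * lorentz_sum q (\<lambda>k. u (2 powi k))"
    unfolding lorentz_sum_def by (rule infsum_int_cmult)
  finally show ?thesis .
qed

lemma lorentz_sum_le_integral: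
  assumes q: "0 < q" and u: "\<And>l m. 0 < l \<Longrightarrow> l \<le> m \<Longrightarrow> u m \<le> u l"
  shows "lorentz_sum q (\<lambda>k. u (2 powi k)) \<le> ennreal (2 * 2 powr q) * lorentz_integral q u"
proof -
  define c where "c k = ennreal (2 powr (real_of_int k * q)) * enn_powr (u (2 powi (k + 1))) q
      * ennreal (1 / 2 powi (k + 1))" for k
  have "c (dyadic_level l) \<le> ennreal (l powr q) * enn_powr (u l) q * ennreal (1 / l)" if "0 < l" for l
  proof -
    let ?k = "dyadic_level l"
    have l: "2 powi ?k < l" "l \<le> 2 powi (?k + 1)"
      using dyadic_level_iff[OF that, of ?k] by auto
    have "2 powr (real_of_int ?k * q) \<le> l powr q"
      unfolding powr_powi[symmetric] using l that q by (intro powr_mono2) auto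
    moreover have "enn_powr (u (2 powi (?k + 1))) q \<le> enn_powr (u l) q"
      using l that q by (intro enn_powr_mono u) auto
    moreover have "1 / 2 powi (?k + 1) \<le> 1 / l"
      using l that by (intro divide_left_mono) auto
    ultimately show ?thesis
      unfolding c_def by (intro mult_mono ennreal_leI) auto
  qed
  then have I: "(\<integral>\<^sup>+l\<in>{0<..}. c (dyadic_level l) \<partial>lborel) \<le> lorentz_integral q u"
    unfolding lorentz_integral_def by (intro nn_integral_mono) (auto simp: indicator_def)
  have e: "ennreal (2 powr (real_of_int (k + 1) * q)) * enn_powr (u (2 powi (k + 1))) q
      = ennreal (2 * 2 powr q) * (c k * ennreal (2 powi k))" for k
  proof -
    have m: "ennreal a * ennreal b * ennreal c * ennreal d = ennreal (a * b * c * d)"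
      if "0 \<le> a" "0 \<le> b" "0 \<le> c" "0 \<le> d" for a b c d
      using that by (simp add: ennreal_mult)
    have "ennreal (2 * 2 powr q) * (c k * ennreal (2 powi k))
        = (ennreal (2 * 2 powr q) * ennreal (2 powr (real_of_int k * q))
            * ennreal (1 / 2 powi (k + 1)) * ennreal (2 powi k)) * enn_powr (u (2 powi (k + 1))) q"
      unfolding c_def by (simp add: mult_ac)
    also have "ennreal (2 * 2 powr q) * ennreal (2 powr (real_of_int k * q))
            * ennreal (1 / 2 powi (k + 1)) * ennreal (2 powi k)
        = ennreal ((2 * 2 powr q) * 2 powr (real_of_int k * q) * (1 / 2 powi (k + 1)) * 2 powi k)"
      by (rule m) auto
    also have "(2 * 2 powr q) * 2 powr (real_of_int k * q) * (1 / 2 powi (k + 1)) * 2 powi k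
        = 2 powr (real_of_int (k + 1) * q)"
      by (simp add: power_int_add powr_add[symmetric] algebra_simps)
    finally show ?thesis ..
  qed
  have "lorentz_sum q (\<lambda>k. u (2 powi k))
      = (\<Sum>\<^sub>\<infinity>k. ennreal (2 powr (real_of_int (k + 1) * q)) * enn_powr (u (2 powi (k + 1))) q)"
    unfolding lorentz_sum_def
    by (rule infsum_int_shift[where m = 1, symmetric])
  also have "\<dots> = ennreal (2 * 2 powr q) * (\<Sum>\<^sub>\<infinity>k. c k * ennreal (2 powi k))"
    unfolding e by (rule infsum_int_cmult)
  also have "\<dots> = ennreal (2 * 2 powr q) * (\<integral>\<^sup>+l\<in>{0<..}. c (dyadic_level l) \<partial>lborel)"
    by (simp only: nn_integral_dyadic_step)
  also have "\<dots> \<le> ennreal (2 * 2 powr q) * lorentz_integral q u"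
    by (rule mult_left_mono[OF I]) simp
  finally show ?thesis .
qed

section \<open>Variable Lebesgue quasi-norms of indicators\<close>

text \<open>Only positivity of the essential infimum of the exponent matters here; \<open>\<delta>\<close> is any positive
  lower bound.\<close>

locale variable_exponent = prob_space M for M :: "'a measure" +
  fixes p :: "'a \<Rightarrow> real" and \<delta> :: real
  assumes p_measurable [measurable]: "p \<in> borel_measurable M"
    and \<delta>_pos: "0 < \<delta>"
    and \<delta>_le_p: "AE x in M. \<delta> \<le> p x"
begin

text \<open>The modular of \<open>\<chi>\<^sub>A / l\<close>; the quasi-norm of \<open>\<chi>\<^sub>A\<close> is the infimum of the \<open>l\<close> where it is at most \<open>1\<close>.\<close>

definition modular :: "'a set \<Rightarrow> real \<Rightarrow> ennreal" where
  "modular A l = (\<integral>\<^sup>+x. ennreal ((\<bar>indicat_real A x\<bar> / l) powr p x) \<partial>M)"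

lemma var_norm_set_le:
  "0 < l \<Longrightarrow> modular A l \<le> 1 \<Longrightarrow> var_norm_set M p A \<le> ennreal l"
  unfolding var_norm_def modular_def by (rule Inf_lower) auto

lemma modular_le_1:
  assumes "0 < t" "var_norm_set M p A < ennreal t"
  shows "modular A t \<le> 1"
proof -
  obtain l where l: "0 < l" "modular A l \<le> 1" "ennreal l < ennreal t"
    using assms(2) unfolding var_norm_def modular_def by (auto simp: Inf_less_iff)
  then have "l \<le> t" by (simp add: ennreal_less_iff)
  have "modular A t \<le> modular A l"
    unfolding modular_def
  proof (rule nn_integral_mono_AE)
    show "AE x in M. ennreal ((\<bar>indicat_real A x\<bar> / t) powr p x)
        \<le> ennreal ((\<bar>indicat_real A x\<bar> / l) powr p x)"
      using \<delta>_le_p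
    proof eventually_elim
      case (elim x)
      then show ?case
        using \<delta>_pos l \<open>l \<le> t\<close> \<open>0 < t\<close>
        by (intro ennreal_leI powr_mono2 divide_left_mono) auto
    qed
  qed
  then show ?thesis using l by simp
qed

lemma var_norm_set_mono_AE:
  assumes "AE x in M. x \<in> A \<longrightarrow> x \<in> B"
  shows "var_norm_set M p A \<le> var_norm_set M p B"
proof -
  have "modular A l \<le> modular B l" if "0 < l" for l
    unfolding modular_def
  proof (rule nn_integral_mono_AE)
    show "AE x in M. ennreal ((\<bar>indicat_real A x\<bar> / l) powr p x)
        \<le> ennreal ((\<bar>indicat_real B x\<bar> / l) powr p x)"
      using assms by eventually_elim (auto simp: indicator_def)
  qed
  then have "modular A l \<le> 1" if "0 < l" "modular B l \<le> 1" for l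
    using that order_trans by blast
  then show ?thesis
    unfolding var_norm_def modular_def[symmetric]
    by (intro Inf_superset_mono) auto
qed

lemma var_norm_set_mono: "A \<subseteq> B \<Longrightarrow> var_norm_set M p A \<le> var_norm_set M p B"
  by (rule var_norm_set_mono_AE) auto

lemma var_norm_set_le_1: "var_norm_set M p A \<le> 1"
proof -
  have "modular A 1 \<le> (\<integral>\<^sup>+x. 1 \<partial>M)"
    unfolding modular_def by (intro nn_integral_mono) (auto simp: indicator_def)
  then show ?thesis
    using var_norm_set_le[of 1 A] emeasure_space_1 by simp
qed

lemma var_norm_set_eq_0D:
  assumes [measurable]: "A \<in> sets M" and "var_norm_set M p A = 0"
  shows "AE x in M. x \<notin> A"
proof -
  have "emeasure M A \<le> ennreal e" if "0 < e" "e < 1" for e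
  proof -
    \<comment> \<open>then \<open>e\<^bsup>-1\<^esup> = t\<^bsup>-\<delta>\<^esup> \<le> t\<^bsup>-p(x)\<^esup>\<close>\<close>
    define t where "t = e powr (1 / \<delta>)"
    have t: "0 < t" "t \<le> 1" "t powr \<delta> = e"
      using that \<delta>_pos by (auto simp: t_def powr_powr powr_le1)
    have "modular A t \<le> 1"
      by (rule modular_le_1) (use t assms in auto)
    have "(\<integral>\<^sup>+x. ennreal (1 / e) * indicator A x \<partial>M) \<le> modular A t"
      unfolding modular_def
    proof (rule nn_integral_mono_AE)
      show "AE x in M. ennreal (1 / e) * indicator A x \<le> ennreal ((\<bar>indicat_real A x\<bar> / t) powr p x)"
        using \<delta>_le_p
      proof eventually_elim
        case (elim x)
        have "1 / e = (1 / t) powr \<delta>"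
          using t by (simp add: powr_divide)
        also have "\<dots> \<le> (1 / t) powr p x"
          using t elim by (intro powr_mono) auto
        finally show ?case
          by (auto simp: indicator_def intro: ennreal_leI)
      qed
    qed
    also note \<open>modular A t \<le> 1\<close>
    finally have "ennreal (1 / e) * emeasure M A \<le> 1"
      by (simp add: nn_integral_cmult)
    then have "ennreal e * (ennreal (1 / e) * emeasure M A) \<le> ennreal e * 1"
      by (rule mult_left_mono) simp
    also have "ennreal e * (ennreal (1 / e) * emeasure M A) = emeasure M A"
    proof -
      have "ennreal e * ennreal (1 / e) = 1"
        using that by (subst ennreal_mult[symmetric]) auto
      then show ?thesis by (simp only: mult.assoc[symmetric]) simp
    qed
    finally show ?thesis by simp
  qed
  note small = this
  have "emeasure M A \<le> 0"
  proof (rule dense_ge)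
    fix y :: ennreal assume "0 < y"
    obtain e where e: "0 < e" "ennreal e \<le> y"
    proof (cases y)
      case (real t)
      then show ?thesis using that[of t] \<open>0 < y\<close> by auto
    next
      case top
      then show ?thesis using that[of 1] by auto
    qed
    have "emeasure M A \<le> ennreal (min e (1/2))"
      by (rule small) (use e in auto)
    also have "\<dots> \<le> ennreal e"
      by (rule ennreal_leI) simp
    also note e(2)
    finally show "emeasure M A \<le> y" .
  qed
  then show ?thesis
    by (intro AE_not_in) (auto simp: null_sets_def)
qed

text \<open>A substitute for the triangle inequality of the quasi-norm for exponents that may be
  smaller than \<open>1\<close>: the geometric weights make the modulars summable.\<close>

lemma var_norm_set_UN:
  obtains K :: real where "1 \<le> K"
    "\<And>A :: nat \<Rightarrow> 'a set. (\<And>i. A i \<in> sets M) \<Longrightarrow>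
      var_norm_set M p (\<Union>i. A i) \<le> ennreal K * (SUP i. ennreal ((3/2) ^ i) * var_norm_set M p (A i))"
proof -
  define r :: real where "r = (2/3) powr \<delta>"
  have r: "0 < r" "r < 1"
    using \<delta>_pos powr_less_mono2[of \<delta> "2/3" 1] by (auto simp: r_def)
  \<comment> \<open>\<open>K\<close> is chosen so that \<open>K\<^bsup>-\<delta>\<^esup>\<close> cancels the geometric sum \<open>1 / (1 - r)\<close> of the modulars\<close>
  define K where "K = (1 / (1 - r)) powr (1 / \<delta>)"
  have K: "1 \<le> K"
    unfolding K_def using r \<delta>_pos by (intro ge_one_powr_ge_zero) auto
  have K\<delta>: "(1 / K) powr \<delta> = 1 - r"
    using r \<delta>_pos by (simp add: K_def powr_divide powr_powr)
  have U: "var_norm_set M p (\<Union>i. A i) \<le> ennreal K * (SUP i. ennreal ((3/2) ^ i) * var_norm_set M p (A i))"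
    if [measurable]: "\<And>i. A i \<in> sets M" for A :: "nat \<Rightarrow> 'a set"
  proof -
    define s where "s = (SUP i. ennreal ((3/2) ^ i) * var_norm_set M p (A i))"
    have main: "var_norm_set M p (\<Union>i. A i) \<le> ennreal K * ennreal t" if t: "s < ennreal t" for t
    proof -
      have "0 < ennreal t" using t by (rule order_le_less_trans[OF zero_le])
      then have t0: "0 < t" by simp
      define l where "l i = t / (3/2) ^ i" for i :: nat
      have l0: "0 < l i" for i using t0 by (simp add: l_def)
      have mod: "modular (A i) (l i) \<le> 1" for i
      proof (rule modular_le_1[OF l0])
        have "ennreal ((3/2) ^ i) * var_norm_set M p (A i) \<le> s"
          unfolding s_def by (rule SUP_upper) simp
        from this t have "ennreal ((3/2) ^ i) * var_norm_set M p (A i) < ennreal t"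
          by (rule order_le_less_trans)
        also have "ennreal t = ennreal ((3/2) ^ i) * ennreal (l i)"
          using t0 by (simp add: l_def ennreal_mult[symmetric])
        finally have "\<not> ennreal ((3/2) ^ i) * ennreal (l i) \<le> ennreal ((3/2) ^ i) * var_norm_set M p (A i)"
          by (simp only: not_le)
        then have "\<not> ennreal (l i) \<le> var_norm_set M p (A i)"
          using mult_left_mono[of "ennreal (l i)" "var_norm_set M p (A i)" "ennreal ((3/2) ^ i)"] zero_le by blast
        then show "var_norm_set M p (A i) < ennreal (l i)"
          by (simp only: not_le)
      qed
      have "modular (\<Union>i. A i) (K * t)
          \<le> (\<integral>\<^sup>+x. (\<Sum>i. ennreal ((1 - r) * r ^ i) * ennreal ((\<bar>indicat_real (A i) x\<bar> / l i) powr p x)) \<partial>M)"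
        unfolding modular_def
      proof (rule nn_integral_mono_AE)
        show "AE x in M. ennreal ((\<bar>indicat_real (\<Union>i. A i) x\<bar> / (K * t)) powr p x)
          \<le> (\<Sum>i. ennreal ((1 - r) * r ^ i) * ennreal ((\<bar>indicat_real (A i) x\<bar> / l i) powr p x))"
          using \<delta>_le_p
        proof eventually_elim
          case (elim x)
          show ?case
          proof (cases "x \<in> (\<Union>i. A i)")
            case False
            then show ?thesis by (auto simp: indicator_def)
          next
            case True
            then obtain i where i: "x \<in> A i" by auto
            have "1 / (K * t) = (1 / K) * (2/3) ^ i * (1 / l i)"
              using K t0 by (simp add: l_def field_simps)
            then have "(1 / (K * t)) powr p x = (1 / K * (2/3) ^ i * (1 / l i)) powr p x"
              by simp
            also have "\<dots> = (1 / K) powr p x * ((2/3) ^ i) powr p x * (1 / l i) powr p x"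
              using K l0[of i] by (subst powr_mult) (auto simp del: times_divide_eq_left times_divide_eq_right simp: powr_mult)
            also have "\<dots> \<le> (1 - r) * r ^ i * (1 / l i) powr p x"
            proof -
              have "(1 / K) powr p x \<le> 1 - r"
                unfolding K\<delta>[symmetric] using K elim by (intro powr_mono') auto
              moreover have "((2/3) ^ i) powr p x \<le> ((2/3) ^ i) powr \<delta>"
                using elim by (intro powr_mono') (auto simp: power_le_one)
              moreover have "((2/3) ^ i) powr \<delta> = r ^ i"
                unfolding r_def by (rule power_powr_swap) simp
              ultimately show ?thesis
                using r by (intro mult_right_mono mult_mono) auto
            qed
            finally have "ennreal ((\<bar>indicat_real (\<Union>i. A i) x\<bar> / (K * t)) powr p x)
                \<le> ennreal ((1 - r) * r ^ i) * ennreal ((\<bar>indicat_real (A i) x\<bar> / l i) powr p x)"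
              using i True r by (simp add: ennreal_mult[symmetric] ennreal_leI)
            also have "\<dots> \<le> (\<Sum>i. ennreal ((1 - r) * r ^ i) * ennreal ((\<bar>indicat_real (A i) x\<bar> / l i) powr p x))"
              using sum_le_suminf[OF summableI, of "{i}"
                  "\<lambda>i. ennreal ((1 - r) * r ^ i) * ennreal ((\<bar>indicat_real (A i) x\<bar> / l i) powr p x)"]
              by simp
            finally show ?thesis .
          qed
        qed
      qed
      also have "\<dots> = (\<Sum>i. ennreal ((1 - r) * r ^ i) * modular (A i) (l i))"
        unfolding modular_def by (subst nn_integral_suminf) (auto simp: nn_integral_cmult)
      also have "\<dots> \<le> (\<Sum>i. ennreal ((1 - r) * r ^ i))"
      proof (rule suminf_le[OF _ summableI summableI])
        show "ennreal ((1 - r) * r ^ i) * modular (A i) (l i) \<le> ennreal ((1 - r) * r ^ i)" for i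
          using mult_left_mono[OF mod[of i], of "ennreal ((1 - r) * r ^ i)"] by simp
      qed
      also have "\<dots> = 1"
      proof -
        have "(\<lambda>i. (1 - r) * r ^ i) sums ((1 - r) * (1 / (1 - r)))"
          using r by (intro sums_mult geometric_sums) auto
        then have "(\<Sum>i. ennreal ((1 - r) * r ^ i)) = ennreal ((1 - r) * (1 / (1 - r)))"
          using r by (intro suminf_ennreal_eq) auto
        then show ?thesis
          using r by simp
      qed
      finally have "var_norm_set M p (\<Union>i. A i) \<le> ennreal (K * t)"
        using K t0 by (intro var_norm_set_le) auto
      then show ?thesis
        using K t0 by (simp add: ennreal_mult)
    qed
    have "var_norm_set M p (\<Union>i. A i) / ennreal K \<le> s"
    proof (rule dense_ge)
      fix y assume y: "s < y"
      show "var_norm_set M p (\<Union>i. A i) / ennreal K \<le> y"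
      proof (cases y)
        case (real t)
        then have "var_norm_set M p (\<Union>i. A i) \<le> ennreal K * y"
          using main[of t] y by simp
        then show ?thesis
          using K by (intro divide_le_posI_ennreal) auto
      qed simp
    qed
    then have "ennreal K * (var_norm_set M p (\<Union>i. A i) / ennreal K) \<le> ennreal K * s"
      by (rule mult_left_mono) simp
    also have "ennreal K * (var_norm_set M p (\<Union>i. A i) / ennreal K)
        = var_norm_set M p (\<Union>i. A i) * ennreal K / ennreal K"
      by (simp only: ennreal_times_divide mult.commute[of "ennreal K"])
    also have "\<dots> = var_norm_set M p (\<Union>i. A i)"
      using K by (intro mult_divide_eq_ennreal) auto
    finally show ?thesis
      unfolding s_def .
  qed
  show ?thesis
    by (rule that[of K, OF K]) (rule U)
qed

end

section \<open>Comparison of Lorentz and dyadic quasi-norms\<close>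

text \<open>The \<open>\<ell>\<^sub>q\<close> quasi-norm of the sequence \<open>2\<^sup>k v\<^sub>k\<close>.\<close>

definition dyadic_value :: "ennreal \<Rightarrow> (int \<Rightarrow> ennreal) \<Rightarrow> ennreal" where
  "dyadic_value q v =
     (if q = \<infinity> then (SUP k. ennreal (2 powi k) * v k)
      else enn_powr (lorentz_sum (enn2real q) v) (1 / enn2real q))"

lemma dyadic_norm_eq: "dyadic_norm M p q \<tau> = dyadic_value q (\<lambda>k. tau_norm M p (\<tau> k))"
  by (simp add: dyadic_norm_def dyadic_value_def lorentz_sum_def)

lemma dyadic_value_ge:
  assumes "0 < q"
  shows "ennreal (2 powi k) * v k \<le> dyadic_value q v"
proof (cases "q = \<infinity>")
  case True
  then show ?thesis
    unfolding dyadic_value_def by (auto intro: SUP_upper)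
next
  case False
  define r where "r = enn2real q"
  have r: "0 < r" using assms False by (simp add: r_def enn2real_positive_iff less_top)
  have "ennreal (2 powi k) * v k = enn_powr (enn_powr (ennreal (2 powi k) * v k) r) (1 / r)"
    using r by simp
  also have "enn_powr (ennreal (2 powi k) * v k) r = ennreal (2 powr (real_of_int k * r)) * enn_powr (v k) r"
    using r by (simp add: enn_powr_mult powr_powi)
  also have "enn_powr \<dots> (1 / r) \<le> enn_powr (lorentz_sum r v) (1 / r)"
    unfolding lorentz_sum_def using r
    by (intro enn_powr_mono infsum_int_ge_member[of "\<lambda>k. ennreal (2 powr (real_of_int k * r)) * enn_powr (v k) r"]) auto
  finally show ?thesis
    unfolding dyadic_value_def r_def[symmetric] if_not_P[OF False] .
qed

text \<open>A supremum is bounded by the \<open>\<ell>\<^sub>q\<close> norm, so that the \<open>q\<close>-th power of the right-hand side becomes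
  a sum over \<open>i\<close>; after shifting, its \<open>i\<close>-th term carries the factor \<open>(3/4)\<^bsup>iq\<^esup>\<close>.  This treats
  \<open>q < 1\<close> and \<open>q \<ge> 1\<close> alike.\<close>

lemma lorentz_sum_geometric:
  assumes q: "0 < q" and "0 \<le> K"
    and le: "\<And>j. u (j + 2) \<le> ennreal K * (SUP i. ennreal ((3/2) ^ i) * v (j + int i))"
  shows "lorentz_sum q u
    \<le> ennreal (K powr q * 4 powr q / (1 - (3/4) powr q)) * lorentz_sum q v"
proof -
  define w where "w k = ennreal (2 powr (real_of_int k * q)) * enn_powr (v k) q" for k
  define \<rho> :: real where "\<rho> = (3/4) powr q"
  have \<rho>: "0 < \<rho>" "\<rho> < 1"
    using q powr_less_mono2[of q "3/4" 1] by (auto simp: \<rho>_def)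
  have term_le: "ennreal (2 powr (real_of_int j * q)) * enn_powr (u j) q
      \<le> ennreal (K powr q * 4 powr q) * (\<Sum>i. ennreal (\<rho> ^ i) * w (j - 2 + int i))" for j
  proof -
    define b where "b i = ennreal ((3/2) ^ i) * v (j - 2 + int i)" for i :: nat
    have "(SUP i. b i) \<le> enn_powr (\<Sum>i. enn_powr (b i) q) (1 / q)"
    proof (rule SUP_least)
      fix i
      have "b i = enn_powr (enn_powr (b i) q) (1 / q)"
        using q by simp
      also have "\<dots> \<le> enn_powr (\<Sum>i. enn_powr (b i) q) (1 / q)"
        using q sum_le_suminf[OF summableI, of "{i}" "\<lambda>i. enn_powr (b i) q"]
        by (intro enn_powr_mono) auto
      finally show "b i \<le> enn_powr (\<Sum>i. enn_powr (b i) q) (1 / q)" .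
    qed
    then have "enn_powr (SUP i. b i) q \<le> (\<Sum>i. enn_powr (b i) q)"
      using enn_powr_mono[OF q] q by fastforce
    moreover have "enn_powr (u j) q \<le> enn_powr (ennreal K * (SUP i. b i)) q"
      using le[of "j - 2"] q unfolding b_def by (intro enn_powr_mono) auto
    ultimately have "enn_powr (u j) q \<le> ennreal (K powr q) * (\<Sum>i. enn_powr (b i) q)"
      using \<open>0 \<le> K\<close> q by (simp add: enn_powr_mult mult_left_mono order_trans)
    then have "ennreal (2 powr (real_of_int j * q)) * enn_powr (u j) q
        \<le> ennreal (2 powr (real_of_int j * q)) * (ennreal (K powr q) * (\<Sum>i. enn_powr (b i) q))"
      by (rule mult_left_mono) simp
    also have "\<dots> = ennreal (K powr q) * (\<Sum>i. ennreal (2 powr (real_of_int j * q)) * enn_powr (b i) q)"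
      by (simp add: mult_ac)
    also have "(\<Sum>i. ennreal (2 powr (real_of_int j * q)) * enn_powr (b i) q)
        = (\<Sum>i. ennreal (4 powr q) * (ennreal (\<rho> ^ i) * w (j - 2 + int i)))"
    proof (rule suminf_cong)
      fix i
      have "(3/2::real) ^ i = 2 ^ i * (3/4) ^ i"
        by (simp add: power_mult_distrib[symmetric])
      then have "2 powi j * (3/2) ^ i = 4 * (3/4) ^ i * (2::real) powi (j - 2 + int i)"
        by (simp add: power_int_add power_int_diff)
      then have "(2 powi j * (3/2) ^ i) powr q = (4 * (3/4) ^ i * (2::real) powi (j - 2 + int i)) powr q"
        by simp
      then have "2 powr (real_of_int j * q) * ((3/2) ^ i) powr q
          = 4 powr q * \<rho> ^ i * 2 powr (real_of_int (j - 2 + int i) * q)"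
        by (simp add: powr_mult powr_powi \<rho>_def power_powr_swap)
      then have "ennreal (2 powr (real_of_int j * q)) * ennreal (((3/2) ^ i) powr q)
          = ennreal (4 powr q) * ennreal (\<rho> ^ i) * ennreal (2 powr (real_of_int (j - 2 + int i) * q))"
        using \<rho> by (simp only: ennreal_mult[symmetric] powr_ge_zero mult_nonneg_nonneg zero_le_power less_imp_le)
      then show "ennreal (2 powr (real_of_int j * q)) * enn_powr (b i) q
          = ennreal (4 powr q) * (ennreal (\<rho> ^ i) * w (j - 2 + int i))"
        unfolding b_def w_def using q
        by (simp add: enn_powr_mult mult.assoc[symmetric])
    qed
    also have "\<dots> = ennreal (4 powr q) * (\<Sum>i. ennreal (\<rho> ^ i) * w (j - 2 + int i))"
      by simp
    finally show ?thesis
      by (simp add: ennreal_mult mult.assoc)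
  qed
  have "lorentz_sum q u
      \<le> (\<Sum>\<^sub>\<infinity>j. ennreal (K powr q * 4 powr q) * (\<Sum>i. ennreal (\<rho> ^ i) * w (j - 2 + int i)))"
    unfolding lorentz_sum_def by (rule infsum_int_mono) (rule term_le)
  also have "\<dots> = ennreal (K powr q * 4 powr q) * (\<Sum>\<^sub>\<infinity>j. (\<Sum>i. ennreal (\<rho> ^ i) * w (j - 2 + int i)))"
    by (rule infsum_int_cmult)
  also have "(\<Sum>\<^sub>\<infinity>j. (\<Sum>i. ennreal (\<rho> ^ i) * w (j - 2 + int i)))
      = (\<Sum>i. \<Sum>\<^sub>\<infinity>j. ennreal (\<rho> ^ i) * w (j - 2 + int i))"
    unfolding infsum_int_eq_nn_integral by (rule nn_integral_suminf) auto
  also have "\<dots> = (\<Sum>i. ennreal (\<rho> ^ i) * (\<Sum>\<^sub>\<infinity>j. w j))"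
    using infsum_int_shift[of w "int i - 2" for i]
    by (simp add: infsum_int_cmult algebra_simps)
  also have "\<dots> = (\<Sum>i. ennreal (\<rho> ^ i)) * (\<Sum>\<^sub>\<infinity>j. w j)"
    by simp
  also have "(\<Sum>i. ennreal (\<rho> ^ i)) = ennreal (1 / (1 - \<rho>))"
    using \<rho> geometric_sums[of \<rho>] by (intro suminf_ennreal_eq) auto
  also have "(\<Sum>\<^sub>\<infinity>j. w j) = lorentz_sum q v"
    by (simp add: w_def lorentz_sum_def)
  finally show ?thesis
    using \<rho> by (simp add: \<rho>_def[symmetric] mult.assoc[symmetric] ennreal_mult[symmetric])
qed

context variable_exponent
begin

lemma lorentz_norm_finite_eq:
  assumes "q \<noteq> \<infinity>"
  shows "lorentz_norm M p q g = enn_powr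
    (lorentz_integral (enn2real q) (\<lambda>l. var_norm_set M p {x \<in> space M. ennreal l < g x})) (1 / enn2real q)"
  using assms by (simp add: lorentz_norm_def lorentz_integral_def)

lemma level_antimono:
  "l \<le> m \<Longrightarrow> var_norm_set M p {x \<in> space M. ennreal m < g x} \<le> var_norm_set M p {x \<in> space M. ennreal l < g x}"
  by (rule var_norm_set_mono) (auto intro: order_le_less_trans ennreal_leI)

lemma lorentz_norm_le_dyadic:
  assumes q: "0 < q" and K: "1 \<le> K"
  obtains C :: real where "0 < C"
    "\<And>g v. (\<And>j. var_norm_set M p {x \<in> space M. ennreal (2 powi (j + 2)) < g x}
          \<le> ennreal K * (SUP i. ennreal ((3/2) ^ i) * v (j + int i)))
       \<Longrightarrow> lorentz_norm M p q g \<le> ennreal C * dyadic_value q v"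
proof (cases "q = \<infinity>")
  case True
  show ?thesis
  proof
    show "0 < 8 * K" using K by simp
    fix g v
    assume le: "\<And>j. var_norm_set M p {x \<in> space M. ennreal (2 powi (j + 2)) < g x}
          \<le> ennreal K * (SUP i. ennreal ((3/2) ^ i) * v (j + int i))"
    show "lorentz_norm M p q g \<le> ennreal (8 * K) * dyadic_value q v"
      unfolding lorentz_norm_def dyadic_value_def if_P[OF True]
    proof (rule SUP_least)
      fix l :: real assume "l \<in> {0<..}"
      then have l0: "0 < l" by simp
      define k where "k = dyadic_level l - 2"
      have l: "2 powi (k + 2) < l" "l \<le> 2 powi (k + 3)"
        using dyadic_level_iff[OF l0, of "k + 2"] by (auto simp: k_def algebra_simps)
      have "ennreal l * var_norm_set M p {x \<in> space M. ennreal l < g x}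
          \<le> ennreal (2 powi (k + 3)) * var_norm_set M p {x \<in> space M. ennreal (2 powi (k + 2)) < g x}"
        using l by (intro mult_mono ennreal_leI level_antimono) auto
      also have "\<dots> \<le> ennreal (2 powi (k + 3)) * (ennreal K * (SUP i. ennreal ((3/2) ^ i) * v (k + int i)))"
        by (intro mult_left_mono le) simp
      also have "\<dots> = ennreal (8 * K) * (SUP i. ennreal (2 powi k) * (ennreal ((3/2) ^ i) * v (k + int i)))"
      proof -
        have "ennreal (2 powi (k + 3)) * ennreal K = ennreal (8 * K) * ennreal (2 powi k)"
          using K by (subst (1 2) ennreal_mult[symmetric]) (auto simp: power_int_add)
        then show ?thesis
          by (simp add: mult.assoc[symmetric] SUP_mult_left_ennreal)
      qed
      also have "\<dots> \<le> ennreal (8 * K) * (SUP k. ennreal (2 powi k) * v k)"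
      proof (intro mult_left_mono SUP_least)
        fix i :: nat
        have "2 powi k * (3/2) ^ i \<le> (2::real) powi (k + int i)"
          by (simp add: power_int_add power_mono)
        then have "ennreal (2 powi k) * ennreal ((3/2) ^ i) \<le> ennreal (2 powi (k + int i))"
          by (simp add: ennreal_mult[symmetric] ennreal_leI)
        then have "ennreal (2 powi k) * (ennreal ((3/2) ^ i) * v (k + int i))
            \<le> ennreal (2 powi (k + int i)) * v (k + int i)"
          unfolding mult.assoc[symmetric] by (rule mult_right_mono) simp
        also have "\<dots> \<le> (SUP k. ennreal (2 powi k) * v k)"
          by (rule SUP_upper) simp
        finally show "ennreal (2 powi k) * (ennreal ((3/2) ^ i) * v (k + int i)) \<le> (SUP k. ennreal (2 powi k) * v k)" .
      qed simp
      finally show "ennreal l * var_norm_set M p {x \<in> space M. ennreal l < g x}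
          \<le> ennreal (8 * K) * (SUP k. ennreal (2 powi k) * v k)" .
    qed
  qed
next
  case False
  define r where "r = enn2real q"
  have r: "0 < r" using q False by (simp add: r_def enn2real_positive_iff less_top)
  define B where "B = 2 powr r * (K powr r * 4 powr r / (1 - (3/4) powr r))"
  have lt1: "(3/4) powr r < (1::real)"
    using r powr_less_mono2[of r "3/4" 1] by auto
  then have B: "0 < B" unfolding B_def using K lt1 by (intro mult_pos_pos divide_pos_pos) auto
  show ?thesis
  proof
    show "0 < B powr (1 / r)" using B by simp
    fix g v
    assume le: "\<And>j. var_norm_set M p {x \<in> space M. ennreal (2 powi (j + 2)) < g x}
          \<le> ennreal K * (SUP i. ennreal ((3/2) ^ i) * v (j + int i))"
    let ?u = "\<lambda>l. var_norm_set M p {x \<in> space M. ennreal l < g x}"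
    have "lorentz_integral r ?u \<le> ennreal (2 powr r) * lorentz_sum r (\<lambda>k. ?u (2 powi k))"
      using r by (intro lorentz_integral_le_sum level_antimono) auto
    also have "\<dots> \<le> ennreal (2 powr r) * (ennreal (K powr r * 4 powr r / (1 - (3/4) powr r)) * lorentz_sum r v)"
      using K r le by (intro mult_left_mono lorentz_sum_geometric) auto
    also have "\<dots> = ennreal B * lorentz_sum r v"
      unfolding B_def using lt1 by (subst ennreal_mult) (auto simp: mult.assoc)
    finally have "enn_powr (lorentz_integral r ?u) (1 / r) \<le> enn_powr (ennreal B * lorentz_sum r v) (1 / r)"
      using r by (intro enn_powr_mono) auto
    then show "lorentz_norm M p q g \<le> ennreal (B powr (1 / r)) * dyadic_value q v"
      using r B False by (simp add: lorentz_norm_finite_eq dyadic_value_def r_def[symmetric] enn_powr_mult)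
  qed
qed

lemma dyadic_le_lorentz_norm:
  assumes q: "0 < q"
  obtains C :: real where "0 < C"
    "\<And>g. dyadic_value q (\<lambda>k. var_norm_set M p {x \<in> space M. ennreal (2 powi k) < g x})
       \<le> ennreal C * lorentz_norm M p q g"
proof (cases "q = \<infinity>")
  case True
  show ?thesis
  proof
    show "0 < (1::real)" by simp
    show "dyadic_value q (\<lambda>k. var_norm_set M p {x \<in> space M. ennreal (2 powi k) < g x})
       \<le> ennreal 1 * lorentz_norm M p q g" for g
      unfolding lorentz_norm_def dyadic_value_def if_P[OF True]
      by (auto intro!: SUP_least SUP_upper2)
  qed
next
  case False
  define r where "r = enn2real q"
  have r: "0 < r" using q False by (simp add: r_def enn2real_positive_iff less_top)
  show ?thesis
  proof
    show "0 < (2 * 2 powr r) powr (1 / r)" by simp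
    fix g
    let ?u = "\<lambda>l. var_norm_set M p {x \<in> space M. ennreal l < g x}"
    have "lorentz_sum r (\<lambda>k. ?u (2 powi k)) \<le> ennreal (2 * 2 powr r) * lorentz_integral r ?u"
      using r by (intro lorentz_sum_le_integral level_antimono) auto
    then have "enn_powr (lorentz_sum r (\<lambda>k. ?u (2 powi k))) (1 / r)
        \<le> enn_powr (ennreal (2 * 2 powr r) * lorentz_integral r ?u) (1 / r)"
      using r by (intro enn_powr_mono) auto
    then show "dyadic_value q (\<lambda>k. ?u (2 powi k)) \<le> ennreal ((2 * 2 powr r) powr (1 / r)) * lorentz_norm M p q g"
      using r
      by (simp only: lorentz_norm_finite_eq[OF False] dyadic_value_def if_not_P[OF False] r_def[symmetric] enn_powr_mult
          enn_powr_ennreal zero_less_divide_1_iff mult_nonneg_nonneg powr_ge_zero zero_le_numeral)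
  qed
qed

end

section \<open>Martingales with square-summable increments\<close>

locale filtered_prob_space = prob_space M for M :: "'a measure" +
  fixes F :: "nat \<Rightarrow> 'a measure"
  assumes sub: "\<And>n. subalgebra M (F n)"
    and sets_F_mono: "\<And>m n. m \<le> n \<Longrightarrow> sets (F m) \<subseteq> sets (F n)"
begin

sublocale sfs: sigma_finite_subalgebra M "F n" for n
  by (intro finite_measure_subalgebra_is_sigma_finite finite_measure_subalgebra.intro
      finite_measure_subalgebra_axioms.intro sub) unfold_locales

lemma space_F [simp]: "space (F n) = space M"
  using sub[of n] by (simp add: subalgebra_def)

lemma sets_F_M: "A \<in> sets (F n) \<Longrightarrow> A \<in> sets M"
  using sub[of n] by (auto simp: subalgebra_def)

lemma measurable_F_M: "f \<in> measurable (F n) N \<Longrightarrow> f \<in> measurable M N"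
  by (rule measurable_from_subalg[OF sub])

lemma subalgebra_F: "m \<le> n \<Longrightarrow> subalgebra (F n) (F m)"
  using sets_F_mono by (simp add: subalgebra_def)

lemma measurable_F_mono: "m \<le> n \<Longrightarrow> f \<in> measurable (F m) N \<Longrightarrow> f \<in> measurable (F n) N"
  by (rule measurable_from_subalg[OF subalgebra_F])

lemma integral_indicator_eq:
  assumes "integrable M f" "integrable M g" "A \<in> sets (F n)"
    and "AE x in M. real_cond_exp M (F n) f x = real_cond_exp M (F n) g x"
  shows "(\<integral>x. indicat_real A x * f x \<partial>M) = (\<integral>x. indicat_real A x * g x \<partial>M)"
proof -
  have "(\<integral>x\<in>A. f x \<partial>M) = (\<integral>x\<in>A. real_cond_exp M (F n) f x \<partial>M)"
    by (rule sfs.real_cond_exp_intA) (use assms in auto)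
  also have "\<dots> = (\<integral>x\<in>A. real_cond_exp M (F n) g x \<partial>M)"
    unfolding set_lebesgue_integral_def
    using assms(3,4) sets_F_M[OF assms(3)] by (intro integral_cong_AE) auto
  also have "\<dots> = (\<integral>x\<in>A. g x \<partial>M)"
    by (rule sfs.real_cond_exp_intA[symmetric]) (use assms in auto)
  finally show ?thesis
    by (simp add: set_lebesgue_integral_def)
qed

lemma integrable_mult_of_squares:
  fixes f g :: "'a \<Rightarrow> real"
  assumes [measurable]: "f \<in> borel_measurable M" "g \<in> borel_measurable M"
    and "integrable M (\<lambda>x. (f x)\<^sup>2)" "integrable M (\<lambda>x. (g x)\<^sup>2)"
  shows "integrable M (\<lambda>x. f x * g x)"
proof (rule Bochner_Integration.integrable_bound)
  show "integrable M (\<lambda>x. (f x)\<^sup>2 + (g x)\<^sup>2)"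
    using assms by simp
  show "AE x in M. norm (f x * g x) \<le> norm ((f x)\<^sup>2 + (g x)\<^sup>2)"
  proof (rule AE_I2)
    fix x
    have "2 * (\<bar>f x\<bar> * \<bar>g x\<bar>) \<le> (f x)\<^sup>2 + (g x)\<^sup>2"
      using sum_squares_bound[of "\<bar>f x\<bar>" "\<bar>g x\<bar>"] by simp
    moreover have "0 \<le> \<bar>f x\<bar> * \<bar>g x\<bar>" by simp
    ultimately have "\<bar>f x\<bar> * \<bar>g x\<bar> \<le> (f x)\<^sup>2 + (g x)\<^sup>2" by linarith
    then show "norm (f x * g x) \<le> norm ((f x)\<^sup>2 + (g x)\<^sup>2)"
      by (simp add: abs_mult)
  qed
qed measurable

end

text \<open>An adapted sequence of square-integrable martingale differences; \<open>e 0\<close> need not be centred.\<close>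

locale square_martingale_difference = filtered_prob_space +
  fixes e :: "nat \<Rightarrow> 'a \<Rightarrow> real"
  assumes e_adapted: "\<And>m. e m \<in> borel_measurable (F m)"
    and e_square: "\<And>m. integrable M (\<lambda>x. (e m x)\<^sup>2)"
    and e_diff: "\<And>m. AE x in M. real_cond_exp M (F m) (e (Suc m)) x = 0"
begin

lemma e_measurable [measurable]: "e m \<in> borel_measurable M"
  by (rule measurable_F_M[OF e_adapted])

lemma e_integrable [simp]: "integrable M (e m)"
  by (rule square_integrable_imp_integrable[OF e_measurable e_square])

lemma sum_measurable_F:
  assumes "\<And>i. i \<in> I \<Longrightarrow> i \<le> n"
  shows "(\<lambda>x. \<Sum>i\<in>I. e i x) \<in> borel_measurable (F n)"
  using assms by (intro borel_measurable_sum measurable_F_mono[OF _ e_adapted]) auto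

lemma integral_sum_square:
  "m \<le> n \<Longrightarrow> integrable M (\<lambda>x. (\<Sum>i\<in>{m<..n}. e i x)\<^sup>2) \<and>
    (\<integral>x. (\<Sum>i\<in>{m<..n}. e i x)\<^sup>2 \<partial>M) = (\<Sum>i\<in>{m<..n}. \<integral>x. (e i x)\<^sup>2 \<partial>M)"
proof (induction n rule: dec_induct)
  case base
  then show ?case by simp
next
  case (step n)
  define G where "G x = (\<Sum>i\<in>{m<..n}. e i x)" for x
  have GF: "G \<in> borel_measurable (F n)"
    unfolding G_def by (rule sum_measurable_F) auto
  then have [measurable]: "G \<in> borel_measurable M" by (rule measurable_F_M)
  have G2: "integrable M (\<lambda>x. (G x)\<^sup>2)"
    using step unfolding G_def by simp
  have Ge: "integrable M (\<lambda>x. G x * e (Suc n) x)"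
    using G2 e_square by (intro integrable_mult_of_squares) auto
  have "(\<integral>x. G x * e (Suc n) x \<partial>M) = (\<integral>x. G x * real_cond_exp M (F n) (e (Suc n)) x \<partial>M)"
    by (rule sfs.real_cond_exp_intg(2)[symmetric]) (use Ge GF in auto)
  also have "\<dots> = (\<integral>x. 0 \<partial>M)"
    using e_diff[of n] by (intro integral_cong_AE) auto
  finally have 0: "(\<integral>x. G x * e (Suc n) x \<partial>M) = 0" by simp
  have "{m<..Suc n} = insert (Suc n) {m<..n}" using step by auto
  then have eq: "(\<Sum>i\<in>{m<..Suc n}. f i) = (\<Sum>i\<in>{m<..n}. f i) + f (Suc n)" for f :: "nat \<Rightarrow> real"
    by simp
  have sq: "(\<Sum>i\<in>{m<..Suc n}. e i x)\<^sup>2 = (G x)\<^sup>2 + 2 * (G x * e (Suc n) x) + (e (Suc n) x)\<^sup>2" for x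
    unfolding eq G_def[symmetric] by (simp add: power2_sum)
  show ?case
    unfolding sq unfolding eq using G2 Ge e_square[of "Suc n"] 0 step(3)
    by (simp add: G_def[symmetric])
qed

text \<open>Orthogonality makes the partial sums Cauchy in \<open>L\<^sup>2\<close>; along a subsequence with geometrically
  decaying gaps they converge in \<open>L\<^sup>1\<close>, and the limit closes the martingale.\<close>

lemma closing_variable:
  assumes summ: "summable (\<lambda>m. \<integral>x. (e m x)\<^sup>2 \<partial>M)"
  obtains a where "integrable M a"
    "\<And>n. AE x in M. real_cond_exp M (F n) a x = (\<Sum>i\<le>n. e i x)"
proof -
  define v where "v m = (\<integral>x. (e m x)\<^sup>2 \<partial>M)" for m
  define X where "X n x = (\<Sum>i\<le>n. e i x)" for n x
  have X_int [simp]: "integrable M (X n)" for n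
    unfolding X_def by simp
  have "\<forall>j. \<exists>N. \<forall>m\<ge>N. \<forall>n. norm (sum v {m..<n}) < (1/4) ^ j"
    using summ unfolding v_def[symmetric] summable_Cauchy by simp
  then obtain N where N: "\<And>j m n. N j \<le> m \<Longrightarrow> norm (sum v {m..<n}) < (1/4) ^ j"
    by metis
  \<comment> \<open>summing makes the subsequence increasing and cofinal\<close>
  define r where "r j = (\<Sum>i\<le>j. N i + 1)" for j
  have r_Suc: "r j \<le> r (Suc j)" for j by (simp add: r_def)
  have r_N: "N j \<le> r j" for j
    unfolding r_def using member_le_sum[of j "{..j}" "\<lambda>i. N i + 1"] by simp
  have r_ge: "j \<le> r j" for j
    by (induction j) (auto simp: r_def)
  define g where "g j x = (\<Sum>i\<in>{r j<..r (Suc j)}. e i x)" for j x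
  have g_meas [measurable]: "g j \<in> borel_measurable M" for j
    unfolding g_def by measurable
  have g_int [simp]: "integrable M (g j)" for j
    unfolding g_def by simp
  have g_X: "g j x = X (r (Suc j)) x - X (r j) x" for j x
  proof -
    have "{..r (Suc j)} = {..r j} \<union> {r j<..r (Suc j)}" using r_Suc[of j] by auto
    then have "X (r (Suc j)) x = X (r j) x + g j x"
      unfolding X_def g_def by (simp add: sum.union_disjoint ivl_disj_int)
    then show ?thesis by simp
  qed
  have g_norm: "(\<integral>x. norm (g j x) \<partial>M) \<le> (1/2) ^ j" for j
  proof -
    have g2: "integrable M (\<lambda>x. (g j x)\<^sup>2)" "(\<integral>x. (g j x)\<^sup>2 \<partial>M) = sum v {r j<..r (Suc j)}"
      using integral_sum_square[OF r_Suc[of j]] unfolding g_def v_def by auto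
    have "{r j<..r (Suc j)} = {Suc (r j)..<Suc (r (Suc j))}" by auto
    then have "sum v {r j<..r (Suc j)} \<le> (1/4) ^ j"
      using N[of j "Suc (r j)" "Suc (r (Suc j))"] r_N[of j] by simp
    then have le: "(\<integral>x. (g j x)\<^sup>2 \<partial>M) \<le> (1/4) ^ j" using g2 by simp
    \<comment> \<open>the arithmetic-geometric mean inequality takes the place of Jensen's\<close>
    have "(\<integral>x. norm (g j x) \<partial>M) \<le> (\<integral>x. (2 ^ j * (g j x)\<^sup>2 + (1/2) ^ j) / 2 \<partial>M)"
    proof (rule integral_mono)
      show "integrable M (\<lambda>x. norm (g j x))" by simp
      show "integrable M (\<lambda>x. (2 ^ j * (g j x)\<^sup>2 + (1/2) ^ j) / 2)" using g2 by simp
      fix x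
      have eq: "c * (\<bar>y\<bar> - d)\<^sup>2 = c * y\<^sup>2 - 2 * (c * d) * \<bar>y\<bar> + (c * d) * d" for c d y :: real
        by (simp add: power2_diff algebra_simps power2_eq_square)
      have one: "(2::real) ^ j * (1/2) ^ j = 1"
        unfolding power_mult_distrib[symmetric] by simp
      have "0 \<le> 2 ^ j * (\<bar>g j x\<bar> - (1/2) ^ j)\<^sup>2" by simp
      then show "norm (g j x) \<le> (2 ^ j * (g j x)\<^sup>2 + (1/2) ^ j) / 2"
        unfolding eq one by simp
    qed
    also have "\<dots> = (2 ^ j * (\<integral>x. (g j x)\<^sup>2 \<partial>M) + (1/2) ^ j) / 2"
      using g2(1) by (simp add: prob_space)
    also have "\<dots> \<le> (2 ^ j * (1/4) ^ j + (1/2) ^ j) / 2"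
      using le by (simp add: divide_right_mono)
    also have "(2::real) ^ j * (1/4) ^ j = (1/2) ^ j"
      unfolding power_mult_distrib[symmetric] by simp
    finally show ?thesis by simp
  qed
  have summ_norm: "summable (\<lambda>j. \<integral>x. norm (g j x) \<partial>M)"
    by (rule summable_comparison_test'[OF summable_geometric[of "1/2"], of 0]) (use g_norm in auto)
  have AE_summ: "AE x in M. summable (\<lambda>j. norm (g j x))"
  proof -
    have "(\<integral>\<^sup>+x. (\<Sum>j. ennreal (norm (g j x))) \<partial>M) = (\<Sum>j. \<integral>\<^sup>+x. ennreal (norm (g j x)) \<partial>M)"
      by (rule nn_integral_suminf) measurable
    also have "\<dots> = (\<Sum>j. ennreal (\<integral>x. norm (g j x) \<partial>M))"
      by (intro suminf_cong nn_integral_eq_integral) auto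
    also have "\<dots> \<noteq> \<infinity>"
      unfolding infinity_ennreal_def by (rule ennreal_suminf_neq_top[OF summ_norm]) simp
    finally have fin: "(\<integral>\<^sup>+x. (\<Sum>j. ennreal (norm (g j x))) \<partial>M) \<noteq> \<infinity>" .
    have "AE x in M. (\<Sum>j. ennreal (norm (g j x))) \<noteq> \<infinity>"
      by (rule nn_integral_noteq_infinite[OF _ fin]) measurable
    then show ?thesis
    proof eventually_elim
      case (elim x)
      then show ?case
        by (intro summable_suminf_not_top) auto
    qed
  qed
  define a where "a x = X (r 0) x + (\<Sum>j. g j x)" for x
  have a_int: "integrable M a"
    unfolding a_def using integrable_suminf[OF g_int AE_summ summ_norm] by simp
  have X_cond: "(\<integral>x. indicat_real A x * X m x \<partial>M) = (\<integral>x. indicat_real A x * X n x \<partial>M)"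
    if "n \<le> m" "A \<in> sets (F n)" for n m A
    using that(1)
  proof (induction m rule: dec_induct)
    case (step m)
    have A: "A \<in> sets (F m)" using that step sets_F_mono by blast
    have [measurable]: "A \<in> sets M" using A by (rule sets_F_M)
    have int: "integrable M (\<lambda>x. indicat_real A x * f x)" if "integrable M f" for f
      using integrable_mult_indicator[OF \<open>A \<in> sets M\<close> that] by simp
    have "(\<integral>x. indicat_real A x * e (Suc m) x \<partial>M) = (\<integral>x. indicat_real A x * 0 \<partial>M)"
    proof (rule integral_indicator_eq[OF _ _ A])
      show "AE x in M. real_cond_exp M (F m) (e (Suc m)) x = real_cond_exp M (F m) (\<lambda>x. 0) x"
      proof -
        have "AE x in M. real_cond_exp M (F m) (\<lambda>x. 0) x = 0"
          by (rule sfs.real_cond_exp_F_meas) auto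
        with e_diff[of m] show ?thesis by eventually_elim simp
      qed
    qed auto
    then have "(\<integral>x. indicat_real A x * X (Suc m) x \<partial>M) = (\<integral>x. indicat_real A x * X m x \<partial>M)"
      using int by (simp add: X_def[of "Suc m"] X_def[of m, symmetric] distrib_left)
    then show ?case using step by simp
  qed simp
  have cond: "AE x in M. real_cond_exp M (F n) a x = X n x" for n
  proof (rule sfs.real_cond_exp_charact[OF _ a_int X_int])
    show "X n \<in> borel_measurable (F n)"
      unfolding X_def by (rule sum_measurable_F) auto
    fix A assume A: "A \<in> sets (F n)"
    have [measurable]: "A \<in> sets M" using A by (rule sets_F_M)
    have int: "integrable M (\<lambda>x. indicat_real A x * f x)" if "integrable M f" for f
      using integrable_mult_indicator[OF \<open>A \<in> sets M\<close> that] by simp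
    let ?I = "\<lambda>f. \<integral>x. indicat_real A x * f x \<partial>M"
    have s1: "(\<lambda>j. ?I (g j)) sums (\<integral>x. (\<Sum>j. indicat_real A x * g j x) \<partial>M)"
    proof (rule sums_integral)
      show "integrable M (\<lambda>x. indicat_real A x * g j x)" for j by (rule int) simp
      show "AE x in M. summable (\<lambda>j. norm (indicat_real A x * g j x))"
        using AE_summ by eventually_elim (simp add: abs_mult)
      show "summable (\<lambda>j. \<integral>x. norm (indicat_real A x * g j x) \<partial>M)"
      proof (rule summable_comparison_test'[OF summ_norm, of 0])
        fix j
        have "(\<integral>x. norm (indicat_real A x * g j x) \<partial>M) \<le> (\<integral>x. norm (g j x) \<partial>M)"
        proof (rule integral_mono)
          show "integrable M (\<lambda>x. norm (indicat_real A x * g j x))"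
            by (intro integrable_norm int) simp
        qed (auto simp: indicator_def)
        then show "norm (\<integral>x. norm (indicat_real A x * g j x) \<partial>M) \<le> (\<integral>x. norm (g j x) \<partial>M)"
          by simp
      qed
    qed
    have e1: "(\<integral>x. (\<Sum>j. indicat_real A x * g j x) \<partial>M) = ?I (\<lambda>x. \<Sum>j. g j x)"
      using AE_summ by (intro integral_cong_AE) (auto elim!: eventually_mono simp: suminf_mult summable_norm_cancel)
    have e2: "(\<lambda>j. ?I (g j)) = (\<lambda>j. ?I (X (r (Suc j))) - ?I (X (r j)))"
      using int by (simp add: g_X right_diff_distrib)
    have s2: "(\<lambda>j. ?I (X (r (Suc j))) - ?I (X (r j))) sums (?I (X n) - ?I (X (r 0)))"
    proof (rule telescope_sums)
      have "eventually (\<lambda>j. ?I (X (r j)) = ?I (X n)) sequentially"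
        using eventually_ge_at_top[of n]
      proof eventually_elim
        case (elim j)
        then show ?case using r_ge[of j] by (intro X_cond A) simp
      qed
      then show "(\<lambda>j. ?I (X (r j))) \<longlonglongrightarrow> ?I (X n)"
        by (rule tendsto_eventually)
    qed
    have "?I (\<lambda>x. \<Sum>j. g j x) = ?I (X n) - ?I (X (r 0))"
      by (rule sums_unique2[OF s1[unfolded e1 e2] s2])
    moreover have "?I a = ?I (X (r 0)) + ?I (\<lambda>x. \<Sum>j. g j x)"
      unfolding a_def distrib_left
      by (rule Bochner_Integration.integral_add[OF int[OF X_int]
            int[OF integrable_suminf[OF g_int AE_summ summ_norm]]])
    ultimately have "?I a = ?I (X n)" by linarith
    then show "(\<integral>x\<in>A. a x \<partial>M) = (\<integral>x\<in>A. X n x \<partial>M)"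
      by (simp add: set_lebesgue_integral_def)
  qed
  show ?thesis
    by (rule that[OF a_int cond[unfolded X_def]])
qed

end

section \<open>Conditional expectations of nonnegative functions\<close>

lemma (in sigma_finite_subalgebra) nn_cond_exp_suminf:
  assumes [measurable]: "\<And>i :: nat. g i \<in> borel_measurable M"
  shows "AE x in M. (\<Sum>i. nn_cond_exp M F (g i) x) = nn_cond_exp M F (\<lambda>x. \<Sum>i. g i x) x"
proof (rule nn_cond_exp_charact)
  fix A assume A: "A \<in> sets F"
  then have [measurable]: "A \<in> sets M" using subalg by (auto simp: subalgebra_def)
  have "(\<integral>\<^sup>+x\<in>A. (\<Sum>i. g i x) \<partial>M) = (\<integral>\<^sup>+x. (\<Sum>i. indicator A x * g i x) \<partial>M)"
    by (simp add: mult.commute)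
  also have "\<dots> = (\<Sum>i. \<integral>\<^sup>+x. indicator A x * g i x \<partial>M)"
    by (rule nn_integral_suminf) measurable
  also have "\<dots> = (\<Sum>i. \<integral>\<^sup>+x. indicator A x * nn_cond_exp M F (g i) x \<partial>M)"
    using A by (intro suminf_cong nn_cond_exp_intg[symmetric]) auto
  also have "\<dots> = (\<integral>\<^sup>+x. (\<Sum>i. indicator A x * nn_cond_exp M F (g i) x) \<partial>M)"
    by (rule nn_integral_suminf[symmetric]) measurable
  also have "\<dots> = (\<integral>\<^sup>+x\<in>A. (\<Sum>i. nn_cond_exp M F (g i) x) \<partial>M)"
    by (simp add: mult.commute)
  finally show "(\<integral>\<^sup>+x\<in>A. (\<Sum>i. g i x) \<partial>M) = (\<integral>\<^sup>+x\<in>A. (\<Sum>i. nn_cond_exp M F (g i) x) \<partial>M)" .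
qed measurable

lemma (in sigma_finite_subalgebra) nn_cond_exp_eq_0D:
  assumes [measurable]: "g \<in> borel_measurable M"
  shows "AE x in M. nn_cond_exp M F g x = 0 \<longrightarrow> g x = 0"
proof -
  define A where "A = {x \<in> space M. nn_cond_exp M F g x = 0}"
  have sp: "space M = space F" using subalg by (simp add: subalgebra_def)
  have A: "A \<in> sets F" unfolding A_def sp by measurable
  then have [measurable]: "A \<in> sets M" using subalg by (auto simp: subalgebra_def)
  have "(\<integral>\<^sup>+x. indicator A x * g x \<partial>M) = (\<integral>\<^sup>+x. indicator A x * nn_cond_exp M F g x \<partial>M)"
    using A by (intro nn_cond_exp_intg[symmetric]) auto
  also have "\<dots> = (\<integral>\<^sup>+x. 0 \<partial>M)"
    by (intro nn_integral_cong) (auto simp: A_def indicator_def)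
  finally have "AE x in M. indicator A x * g x = 0"
    by (simp add: nn_integral_0_iff_AE)
  then show ?thesis
    using AE_space by eventually_elim (auto simp: A_def indicator_def)
qed

section \<open>The conditional square function\<close>

context filtered_prob_space
begin

text \<open>The conditional variance \<open>E\<^bsub>n-1\<^esub>|d\<^sub>n f|\<^sup>2\<close>, with \<open>F\<^bsub>-1\<^esub> = F\<^sub>0\<close>.\<close>

definition cond_var :: "(nat \<Rightarrow> 'a \<Rightarrow> real) \<Rightarrow> nat \<Rightarrow> 'a \<Rightarrow> ennreal" where
  "cond_var f n = nn_cond_exp M (F (n - 1)) (\<lambda>y. ennreal (\<bar>mdiff f n y\<bar>\<^sup>2))"

lemma cond_var_measurable_F: "cond_var f n \<in> borel_measurable (F (n - 1))"
  unfolding cond_var_def by measurable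

lemma cond_var_measurable [measurable]: "cond_var f n \<in> borel_measurable M"
  unfolding cond_var_def by measurable

lemma cond_square_eq: "cond_square M F f x = enn_powr (\<Sum>n. cond_var f n x) (1/2)"
  by (simp add: cond_square_def cond_var_def)

lemma cond_square_measurable [measurable]: "cond_square M F f \<in> borel_measurable M"
  unfolding cond_square_eq[abs_def] by measurable

lemma less_cond_square_iff:
  assumes "0 \<le> l"
  shows "ennreal l < cond_square M F f x \<longleftrightarrow> ennreal (l\<^sup>2) < (\<Sum>n. cond_var f n x)"
proof -
  have e: "ennreal l = enn_powr (ennreal (l\<^sup>2)) (1/2)"
    using assms by (simp add: powr_half_sqrt)
  show ?thesis
    unfolding cond_square_eq by (subst e, rule enn_powr_less_iff) simp
qed

lemma mdiff_measurable:
  "(\<And>n. f n \<in> borel_measurable M) \<Longrightarrow> mdiff f n \<in> borel_measurable M"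
  by (cases n) (auto simp: mdiff_def[abs_def])

lemma martingale_cond_exp:
  assumes "martingale M F f" "k \<le> n"
  shows "AE x in M. real_cond_exp M (F n) (f k) x = f k x"
proof -
  have int: "integrable M (f m)" for m using assms by (simp add: martingale_def)
  have meas [measurable]: "f m \<in> borel_measurable M" for m using int by auto
  define h where "h = real_cond_exp M (F k) (f (Suc k))"
  have h: "AE x in M. h x = f k x" using assms by (simp add: martingale_def h_def)
  have hF: "h \<in> borel_measurable (F n)"
    unfolding h_def by (rule measurable_F_mono[OF assms(2)]) simp
  have h_int: "integrable M h" unfolding h_def by (rule sfs.real_cond_exp_int(1)[OF int])
  then have [measurable]: "h \<in> borel_measurable M" by auto
  have "AE x in M. real_cond_exp M (F n) h x = real_cond_exp M (F n) (f k) x"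
    by (rule sfs.real_cond_exp_cong[OF h]) auto
  moreover have "AE x in M. real_cond_exp M (F n) h x = h x"
    by (rule sfs.real_cond_exp_F_meas[OF h_int hF])
  ultimately show ?thesis using h by eventually_elim simp
qed

text \<open>Increments of a martingale may be switched off by a predictable family of events.  If the
  conditional variances that survive have a bounded sum, the resulting martingale is closed by an
  integrable function.\<close>

lemma predictable_restriction:
  assumes mart: "martingale M F f"
    and B: "\<And>m. B m \<in> sets (F m)"
    and bound: "\<And>x. x \<in> space M \<Longrightarrow> (\<Sum>m. indicator (B m) x * cond_var f (Suc m) x) \<le> ennreal c"
  obtains a where "integrable M a"
    "\<And>n. AE x in M. real_cond_exp M (F n) a x = (\<Sum>m<n. indicat_real (B m) x * mdiff f (Suc m) x)"
proof -
  have f_int [simp]: "integrable M (f m)" for m using mart by (simp add: martingale_def)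
  have f_meas [measurable]: "f m \<in> borel_measurable M" for m
    by (rule borel_measurable_integrable[OF f_int])
  have d: "mdiff f (Suc m) = (\<lambda>x. f (Suc m) x - f m x)" for m
    by (simp add: mdiff_def[abs_def])
  have [measurable]: "B m \<in> sets M" for m using B by (rule sets_F_M)
  \<comment> \<open>\<open>f\<close> is only almost everywhere adapted, so an adapted version of its increments is needed\<close>
  define D where "D m = real_cond_exp M (F (Suc m)) (mdiff f (Suc m))" for m
  have D_int [simp]: "integrable M (D m)" for m
    unfolding D_def d by (intro sfs.real_cond_exp_int) simp
  have D_F [measurable]: "D m \<in> borel_measurable (F (Suc m))" for m
    unfolding D_def by simp
  have D_meas [measurable]: "D m \<in> borel_measurable M" for m by (rule measurable_F_M[OF D_F])
  have D_eq: "AE x in M. D m x = mdiff f (Suc m) x" for m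
  proof -
    have "AE x in M. D m x = real_cond_exp M (F (Suc m)) (f (Suc m)) x - real_cond_exp M (F (Suc m)) (f m) x"
      unfolding D_def d by (rule sfs.real_cond_exp_diff) auto
    moreover note martingale_cond_exp[OF mart, of "Suc m" "Suc m"] martingale_cond_exp[OF mart, of m "Suc m"]
    ultimately show ?thesis unfolding d by auto
  qed
  have D_cond: "AE x in M. real_cond_exp M (F m) (D m) x = 0" for m
  proof -
    have "AE x in M. real_cond_exp M (F m) (D m) x = real_cond_exp M (F m) (mdiff f (Suc m)) x"
      by (rule sfs.real_cond_exp_cong[OF D_eq]) (auto simp: d)
    moreover have "AE x in M. real_cond_exp M (F m) (mdiff f (Suc m)) x
        = real_cond_exp M (F m) (f (Suc m)) x - real_cond_exp M (F m) (f m) x"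
      unfolding d by (rule sfs.real_cond_exp_diff) auto
    moreover have "AE x in M. real_cond_exp M (F m) (f (Suc m)) x = f m x"
      using mart by (simp add: martingale_def)
    moreover note martingale_cond_exp[OF mart, of m m]
    ultimately show ?thesis by auto
  qed
  define e where "e m x = (if m = 0 then 0 else indicat_real (B (m - 1)) x * D (m - 1) x)" for m x
  have e_0: "e 0 = (\<lambda>x. 0)" by (simp add: e_def[abs_def])
  have e_Suc: "e (Suc m) = (\<lambda>x. indicat_real (B m) x * D m x)" for m
    by (simp add: e_def[abs_def])
  have e_nn: "(\<integral>\<^sup>+x. ennreal ((e (Suc m) x)\<^sup>2) \<partial>M) = (\<integral>\<^sup>+x. indicator (B m) x * cond_var f (Suc m) x \<partial>M)" for m
  proof -
    have "(\<integral>\<^sup>+x. ennreal ((e (Suc m) x)\<^sup>2) \<partial>M) = (\<integral>\<^sup>+x. indicator (B m) x * ennreal (\<bar>mdiff f (Suc m) x\<bar>\<^sup>2) \<partial>M)"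
      using D_eq[of m] by (intro nn_integral_cong_AE) (auto elim!: eventually_mono simp: e_Suc indicator_def)
    also have "\<dots> = (\<integral>\<^sup>+x. indicator (B m) x * nn_cond_exp M (F m) (\<lambda>x. ennreal (\<bar>mdiff f (Suc m) x\<bar>\<^sup>2)) x \<partial>M)"
      by (rule sfs.nn_cond_exp_intg[symmetric]) (use B in \<open>auto simp: d\<close>)
    finally show ?thesis by (simp add: cond_var_def)
  qed
  have sum_nn: "(\<Sum>m. \<integral>\<^sup>+x. ennreal ((e (Suc m) x)\<^sup>2) \<partial>M) \<le> ennreal c"
  proof -
    have "(\<Sum>m. \<integral>\<^sup>+x. ennreal ((e (Suc m) x)\<^sup>2) \<partial>M) = (\<integral>\<^sup>+x. (\<Sum>m. indicator (B m) x * cond_var f (Suc m) x) \<partial>M)"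
      unfolding e_nn by (rule nn_integral_suminf[symmetric]) measurable
    also have "\<dots> \<le> (\<integral>\<^sup>+x. ennreal c \<partial>M)"
      by (rule nn_integral_mono) (rule bound)
    finally show ?thesis by (simp add: emeasure_space_1)
  qed
  have e_meas [measurable]: "e m \<in> borel_measurable M" for m
    by (cases m) (auto simp: e_0 e_Suc)
  have e_sq: "integrable M (\<lambda>x. (e m x)\<^sup>2)" for m
  proof (cases m)
    case (Suc k)
    have "(\<integral>\<^sup>+x. ennreal ((e (Suc k) x)\<^sup>2) \<partial>M) \<le> (\<Sum>m. \<integral>\<^sup>+x. ennreal ((e (Suc m) x)\<^sup>2) \<partial>M)"
      using sum_le_suminf[OF summableI, of "{k}" "\<lambda>m. \<integral>\<^sup>+x. ennreal ((e (Suc m) x)\<^sup>2) \<partial>M"] by simp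
    also note sum_nn
    finally have "(\<integral>\<^sup>+x. ennreal ((e m x)\<^sup>2) \<partial>M) < \<infinity>"
      unfolding Suc by (rule order_le_less_trans) simp
    then show ?thesis
      by (intro integrableI_bounded) auto
  qed (simp add: e_0)
  interpret square_martingale_difference M F e
  proof
    show "e m \<in> borel_measurable (F m)" for m
    proof (cases m)
      case (Suc k)
      have "B k \<in> sets (F (Suc k))" using B[of k] sets_F_mono[of k "Suc k"] by auto
      then show ?thesis unfolding Suc e_Suc by measurable
    qed (simp add: e_0)
    show "integrable M (\<lambda>x. (e m x)\<^sup>2)" for m by (rule e_sq)
    show "AE x in M. real_cond_exp M (F m) (e (Suc m)) x = 0" for m
    proof -
      have "AE x in M. real_cond_exp M (F m) (e (Suc m)) x = indicat_real (B m) x * real_cond_exp M (F m) (D m) x"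
        unfolding e_Suc
      proof (rule sfs.real_cond_exp_mult)
        show "indicat_real (B m) \<in> borel_measurable (F m)" using B by simp
        show "integrable M (\<lambda>x. indicat_real (B m) x * D m x)"
          using integrable_mult_indicator[OF \<open>B m \<in> sets M\<close> D_int] by simp
      qed simp
      then show ?thesis using D_cond[of m] by eventually_elim simp
    qed
  qed
  have "summable (\<lambda>m. \<integral>x. (e (Suc m) x)\<^sup>2 \<partial>M)"
  proof (rule summable_suminf_not_top)
    have "ennreal (\<integral>x. (e (Suc m) x)\<^sup>2 \<partial>M) = (\<integral>\<^sup>+x. ennreal ((e (Suc m) x)\<^sup>2) \<partial>M)" for m
      by (rule nn_integral_eq_integral[symmetric]) (use e_sq in auto)
    then show "(\<Sum>m. ennreal (\<integral>x. (e (Suc m) x)\<^sup>2 \<partial>M)) \<noteq> \<top>"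
      using neq_top_trans[OF ennreal_neq_top sum_nn] by simp
  qed simp
  then have "summable (\<lambda>m. \<integral>x. (e m x)\<^sup>2 \<partial>M)"
    by (subst (asm) summable_Suc_iff)
  from closing_variable[OF this] obtain a where a: "integrable M a"
    "\<And>n. AE x in M. real_cond_exp M (F n) a x = (\<Sum>i\<le>n. e i x)" by metis
  have "AE x in M. real_cond_exp M (F n) a x = (\<Sum>m<n. indicat_real (B m) x * mdiff f (Suc m) x)" for n
  proof -
    have "AE x in M. \<forall>m. D m x = mdiff f (Suc m) x"
      using D_eq by (simp add: AE_all_countable)
    with a(2)[of n] show ?thesis
    proof eventually_elim
      case (elim x)
      have "(\<Sum>i\<le>n. e i x) = (\<Sum>i<n. e (Suc i) x)"
        by (simp add: sum.atMost_shift e_0)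
      with elim show ?case by (simp add: e_Suc)
    qed
  qed
  with a(1) show ?thesis by (rule that)
qed

end

section \<open>From the square function to an atomic decomposition\<close>

locale hardy_setting = filtered_prob_space + variable_exponent
begin

text \<open>The partial sums \<open>S\<^sub>n\<close> of the square of the conditional square function.\<close>

definition cond_sum :: "(nat \<Rightarrow> 'a \<Rightarrow> real) \<Rightarrow> nat \<Rightarrow> 'a \<Rightarrow> ennreal" where
  "cond_sum f n x = (\<Sum>i\<le>n. cond_var f i x)"

text \<open>The first \<open>n\<close> with \<open>S\<^bsub>n+1\<^esub> > t\<close>.  Looking one step ahead ensures
  \<open>S\<^sub>m \<le> t\<close> for every \<open>m\<close> from \<open>1\<close> up to and including this time; it gives a stopping time
  because \<open>S\<close> is predictable.\<close>

definition exceed_time :: "(nat \<Rightarrow> 'a \<Rightarrow> real) \<Rightarrow> ennreal \<Rightarrow> 'a \<Rightarrow> enat" where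
  "exceed_time f t x =
    (if \<exists>n. t < cond_sum f (Suc n) x then enat (LEAST n. t < cond_sum f (Suc n) x) else \<infinity>)"

text \<open>The event on which the increment with index \<open>m + 1\<close> occurs after \<open>\<tau>\<^sub>k\<close> but not after
  \<open>\<tau>\<^bsub>k+1\<^esub>\<close>.\<close>

definition band :: "(nat \<Rightarrow> 'a \<Rightarrow> real) \<Rightarrow> int \<Rightarrow> nat \<Rightarrow> 'a set" where
  "band f k m = {x \<in> space M. ennreal ((2 powi k)\<^sup>2) < cond_sum f (Suc m) x
      \<and> cond_sum f (Suc m) x \<le> ennreal ((2 powi (k + 1))\<^sup>2)}"

lemma cond_sum_measurable_F: "cond_sum f (Suc n) \<in> borel_measurable (F n)"
proof -
  have "cond_var f i \<in> borel_measurable (F n)" if "i \<le> Suc n" for i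
    using that by (intro measurable_F_mono[OF _ cond_var_measurable_F]) auto
  then show ?thesis
    unfolding cond_sum_def[abs_def] by (intro borel_measurable_sum) auto
qed

lemma le_exceed_time_iff:
  "enat n \<le> exceed_time f t x \<longleftrightarrow> (\<forall>m<n. cond_sum f (Suc m) x \<le> t)"
proof (cases "\<exists>n. t < cond_sum f (Suc n) x")
  case True
  define l where "l = (LEAST n. t < cond_sum f (Suc n) x)"
  have l: "t < cond_sum f (Suc l) x" unfolding l_def by (rule LeastI_ex[OF True])
  have nl: "cond_sum f (Suc m) x \<le> t" if "m < l" for m
    using not_less_Least[OF that[unfolded l_def]] by (simp add: not_less)
  have e: "exceed_time f t x = enat l" using True by (simp add: exceed_time_def l_def)
  show ?thesis
  proof (cases "n \<le> l")
    case True
    then show ?thesis using e nl by auto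
  next
    case False
    then have "l < n" by simp
    then have "\<not> (\<forall>m<n. cond_sum f (Suc m) x \<le> t)"
      using l leD by blast
    then show ?thesis using e False by simp
  qed
next
  case False
  then have "cond_sum f (Suc m) x \<le> t" for m
    by (simp add: not_less)
  moreover have "exceed_time f t x = \<infinity>"
    unfolding exceed_time_def if_not_P[OF False] ..
  ultimately show ?thesis by simp
qed

lemma exceed_time_finite_iff:
  "exceed_time f t x < \<infinity> \<longleftrightarrow> t < (\<Sum>n. cond_var f n x)"
proof -
  have "(\<Sum>n. cond_var f n x) = (SUP n. cond_sum f (Suc n) x)"
  proof (rule antisym)
    show "(\<Sum>n. cond_var f n x) \<le> (SUP n. cond_sum f (Suc n) x)"
    proof (intro suminf_le_const summableI)
      fix n
      have "(\<Sum>i<n. cond_var f i x) \<le> cond_sum f (Suc n) x"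
        unfolding cond_sum_def by (rule sum_mono2) auto
      also have "\<dots> \<le> (SUP n. cond_sum f (Suc n) x)" by (rule SUP_upper) simp
      finally show "(\<Sum>i<n. cond_var f i x) \<le> (SUP n. cond_sum f (Suc n) x)" .
    qed
    show "(SUP n. cond_sum f (Suc n) x) \<le> (\<Sum>n. cond_var f n x)"
      unfolding cond_sum_def by (intro SUP_least sum_le_suminf summableI) auto
  qed
  then show ?thesis
    by (auto simp: exceed_time_def less_SUP_iff)
qed

lemma exceed_time_stopping: "ext_stopping_time M F (exceed_time f t)"
  unfolding ext_stopping_time_def
proof (rule stopping_timeI)
  fix s :: enat
  show "Measurable.pred (case s of enat n \<Rightarrow> F n | \<infinity> \<Rightarrow> M) (\<lambda>x. exceed_time f t x \<le> s)"
  proof (cases s)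
    case (enat n)
    have "exceed_time f t x \<le> enat n \<longleftrightarrow> \<not> (\<forall>m\<in>{..n}. cond_sum f (Suc m) x \<le> t)" for x
    proof -
      have "exceed_time f t x \<le> enat n \<longleftrightarrow> \<not> enat (Suc n) \<le> exceed_time f t x"
        by (cases "exceed_time f t x") auto
      then show ?thesis by (auto simp: le_exceed_time_iff less_Suc_eq_le)
    qed
    moreover have "Measurable.pred (F n) (\<lambda>x. \<not> (\<forall>m\<in>{..n}. cond_sum f (Suc m) x \<le> t))"
    proof -
      have [measurable]: "cond_sum f (Suc m) \<in> borel_measurable (F n)" if "m \<in> {..n}" for m
        using that by (intro measurable_F_mono[OF _ cond_sum_measurable_F]) auto
      show ?thesis by measurable
    qed
    ultimately show ?thesis by (simp add: enat)
  qed simp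
qed

lemma band_F: "band f k m \<in> sets (F m)"
proof -
  have [measurable]: "cond_sum f (Suc m) \<in> borel_measurable (F m)"
    by (rule cond_sum_measurable_F)
  have "band f k m = {x \<in> space (F m). ennreal ((2 powi k)\<^sup>2) < cond_sum f (Suc m) x
      \<and> cond_sum f (Suc m) x \<le> ennreal ((2 powi (k + 1))\<^sup>2)}"
    by (simp add: band_def)
  also have "\<dots> \<in> sets (F m)" by measurable
  finally show ?thesis .
qed

lemma band_sum_le:
  "(\<Sum>m. indicator (band f k m) x * cond_var f (Suc m) x) \<le> ennreal ((2 powi (k + 1))\<^sup>2)"
proof -
  have "(\<Sum>m. indicator (band f k m) x * cond_var f (Suc m) x)
      = (\<Sum>m. if x \<in> band f k m then cond_var f (Suc m) x else 0)"
    by (intro suminf_cong) (auto simp: indicator_def)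
  also have "\<dots> \<le> ennreal ((2 powi (k + 1))\<^sup>2)"
    by (rule truncated_sum_le) (auto simp: band_def cond_sum_def)
  finally show ?thesis .
qed

lemma band_not_before_exceed_time:
  assumes "enat n \<le> exceed_time f (ennreal ((2 powi k)\<^sup>2)) x" "m < n"
  shows "x \<notin> band f k m"
  using assms by (auto simp: le_exceed_time_iff band_def not_less)

lemma tau_norm_exceed_time:
  "tau_norm M p (exceed_time f (ennreal ((2 powi k)\<^sup>2)))
    = var_norm_set M p {x \<in> space M. ennreal (2 powi k) < cond_square M F f x}"
proof -
  have "exceed_time f (ennreal ((2 powi k)\<^sup>2)) x < \<infinity> \<longleftrightarrow> ennreal (2 powi k) < cond_square M F f x" for x
    unfolding exceed_time_finite_iff by (rule less_cond_square_iff[symmetric]) simp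
  then show ?thesis by (simp only:)
qed

lemma band_has_sum:
  assumes "x \<in> space M" "cond_sum f (Suc m) x < \<infinity>" "cond_sum f (Suc m) x = 0 \<longrightarrow> y = 0"
  shows "((\<lambda>k. indicat_real (band f k m) x * y) has_sum y) UNIV"
proof (cases "cond_sum f (Suc m) x = 0")
  case True
  then show ?thesis using assms by simp
next
  case False
  obtain t where t: "cond_sum f (Suc m) x = ennreal t" "0 \<le> t"
    using assms(2) by (cases "cond_sum f (Suc m) x") auto
  then have "0 < t" using False by (cases "t = 0") auto
  have "x \<in> band f k m \<longleftrightarrow> k = dyadic_level (sqrt t)" for k
  proof -
    have "x \<in> band f k m \<longleftrightarrow> (2 powi k)\<^sup>2 < t \<and> t \<le> (2 powi (k + 1))\<^sup>2"
      using assms(1) t by (simp add: band_def ennreal_less_iff)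
    also have "\<dots> \<longleftrightarrow> 2 powi k < sqrt t \<and> sqrt t \<le> 2 powi (k + 1)"
      using t by (metis real_less_rsqrt real_sqrt_less_iff real_sqrt_le_iff real_sqrt_abs abs_of_pos zero_less_power_int zero_less_numeral)
    also have "\<dots> \<longleftrightarrow> k = dyadic_level (sqrt t)"
      using \<open>0 < t\<close> by (intro dyadic_level_iff) simp
    finally show ?thesis .
  qed
  then show ?thesis
    by (intro has_sum_finite_neutralI[where B = "{dyadic_level (sqrt t)}"]) (auto simp: indicator_def)
qed

lemma AE_mdiff_eq_0:
  assumes "martingale M F f"
  shows "AE x in M. cond_sum f (Suc m) x = 0 \<longrightarrow> mdiff f (Suc m) x = 0"
proof -
  have "\<And>n. f n \<in> borel_measurable M"
    using assms by (auto simp: martingale_def intro: borel_measurable_integrable)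
  then have "mdiff f (Suc m) \<in> borel_measurable M"
    by (rule mdiff_measurable)
  then have "AE x in M. cond_var f (Suc m) x = 0 \<longrightarrow> ennreal (\<bar>mdiff f (Suc m) x\<bar>\<^sup>2) = 0"
    unfolding cond_var_def by (intro sfs.nn_cond_exp_eq_0D) simp
  then show ?thesis
    by eventually_elim (auto simp: cond_sum_def)
qed

text \<open>If \<open>{\<tau>\<^sub>k < \<infinity>}\<close> is a null set, the coefficient and the band increments vanish and the zero function
  serves as the atom.\<close>

lemma exists_band_atom:
  assumes mart: "martingale M F f"
  defines "\<tau> \<equiv> \<lambda>k. exceed_time f (ennreal ((2 powi k)\<^sup>2))"
  shows "\<exists>a. atom M F p (\<tau> k) a \<and> (\<forall>n. AE x in M.
      3 * 2 powi k * enn2real (tau_norm M p (\<tau> k)) * real_cond_exp M (F n) a x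
        = (\<Sum>m<n. indicat_real (band f k m) x * mdiff f (Suc m) x))"
proof -
  define N where "N = tau_norm M p (\<tau> k)"
  define h where "h n x = (\<Sum>m<n. indicat_real (band f k m) x * mdiff f (Suc m) x)" for n x
  have f_meas [measurable]: "f n \<in> borel_measurable M" for n
    using mart by (auto simp: martingale_def intro: borel_measurable_integrable)
  have d_meas [measurable]: "mdiff f n \<in> borel_measurable M" for n
    by (rule mdiff_measurable) simp
  have band_M [measurable]: "band f k m \<in> sets M" for m by (rule sets_F_M[OF band_F])
  have stop: "ext_stopping_time M F (\<tau> k)"
    unfolding \<tau>_def by (rule exceed_time_stopping)
  have h_before: "h n x = 0" if "enat n \<le> \<tau> k x" for n x
    using that band_not_before_exceed_time unfolding h_def \<tau>_def by (intro sum.neutral) (auto simp: indicator_def)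
  show ?thesis
  proof (cases "N = 0")
    case True
    have A: "{x \<in> space M. \<tau> k x < \<infinity>} \<in> sets M"
      unfolding \<tau>_def exceed_time_finite_iff by measurable
    have zero: "AE x in M. real_cond_exp M (F n) (\<lambda>x. 0) x = 0" for n
      by (rule sfs.real_cond_exp_F_meas) auto
    have zero': "AE x in M. enat n \<le> \<tau> k x \<longrightarrow> real_cond_exp M (F n) (\<lambda>x. 0) x = 0" for n
      using zero[of n] by eventually_elim simp
    have "AE x in M. x \<notin> {x \<in> space M. \<tau> k x < \<infinity>}"
      by (rule var_norm_set_eq_0D[OF A]) (use True in \<open>simp add: N_def\<close>)
    then have "AE x in M. h n x = 0" for n
      using AE_space by eventually_elim (auto intro!: h_before)
    then have "AE x in M. 3 * 2 powi k * enn2real N * real_cond_exp M (F n) (\<lambda>x. 0) x = h n x" for n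
      using True by (auto elim!: eventually_mono)
    moreover have "atom M F p (\<tau> k) (\<lambda>x. 0)"
      unfolding atom_def N_def[symmetric] True using stop zero' by simp
    ultimately show ?thesis
      unfolding N_def h_def by blast
  next
    case False
    define tn where "tn = enn2real N"
    have N: "N = ennreal tn" "0 < tn"
    proof -
      have "N \<noteq> \<top>" using var_norm_set_le_1 unfolding N_def by (metis ennreal_one_neq_top top_unique)
      then show "N = ennreal tn" "0 < tn"
        using False by (auto simp: tn_def enn2real_positive_iff less_top zero_less_iff_neq_zero)
    qed
    define w where "w = 3 * 2 powi k * tn"
    have w: "0 < w" using N by (simp add: w_def)
    obtain b where b_int: "integrable M b" and "\<And>n. AE x in M. real_cond_exp M (F n) b x
        = (\<Sum>m<n. indicat_real (band f k m) x * mdiff f (Suc m) x)"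
      by (rule predictable_restriction[where B = "band f k", OF mart band_F band_sum_le]) (rule that)
    then have b_cond: "AE x in M. real_cond_exp M (F n) b x = h n x" for n
      unfolding h_def by blast
    define a where "a x = b x / w" for x
    have a_int: "integrable M a" unfolding a_def using b_int by simp
    have a_cond: "AE x in M. real_cond_exp M (F n) a x = h n x / w" for n
    proof -
      have "AE x in M. real_cond_exp M (F n) a x = real_cond_exp M (F n) b x / w"
        unfolding a_def by (rule sfs.real_cond_exp_cdiv[OF b_int])
      with b_cond[of n] show ?thesis by eventually_elim simp
    qed
    define E where "E n = real_cond_exp M (F n) a" for n
    have dE_Suc: "AE x in M. mdiff E (Suc m) x = indicat_real (band f k m) x * mdiff f (Suc m) x / w" for m
      using a_cond[of m] a_cond[of "Suc m"]
      by eventually_elim (simp add: mdiff_def[of E] E_def h_def diff_divide_distrib[symmetric])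
    have dE_0: "AE x in M. mdiff E 0 x = 0"
      using a_cond[of 0] by eventually_elim (simp add: mdiff_def E_def h_def)
    have [measurable]: "mdiff E n \<in> borel_measurable M" for n
      by (rule mdiff_measurable) (simp add: E_def)
    have cv0: "AE x in M. cond_var E 0 x = 0"
    proof -
      have "AE x in M. cond_var E 0 x = nn_cond_exp M (F (0 - 1)) (\<lambda>x. 0) x"
        unfolding cond_var_def using dE_0
        by (intro sfs.nn_cond_exp_cong) (auto elim!: eventually_mono)
      moreover have "AE x in M. 0 = nn_cond_exp M (F (0 - 1)) (\<lambda>x. 0) x"
        by (rule sfs.nn_cond_exp_F_meas) simp
      ultimately show ?thesis by eventually_elim simp
    qed
    have cvSuc: "AE x in M. cond_var E (Suc m) x
        = ennreal (1 / w\<^sup>2) * (indicator (band f k m) x * cond_var f (Suc m) x)" for m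
    proof -
      let ?i = "\<lambda>x. ennreal (1 / w\<^sup>2) * indicator (band f k m) x"
      let ?d = "\<lambda>x. ennreal (\<bar>mdiff f (Suc m) x\<bar>\<^sup>2)"
      have "AE x in M. cond_var E (Suc m) x = nn_cond_exp M (F m) (\<lambda>x. ?i x * ?d x) x"
        unfolding cond_var_def diff_Suc_1
      proof (rule sfs.nn_cond_exp_cong)
        show "AE x in M. ennreal (\<bar>mdiff E (Suc m) x\<bar>\<^sup>2) = ?i x * ?d x"
          using dE_Suc[of m]
          by eventually_elim (auto simp: indicator_def ennreal_mult[symmetric] power_divide)
      qed measurable
      moreover have "AE x in M. ?i x * nn_cond_exp M (F m) ?d x = nn_cond_exp M (F m) (\<lambda>x. ?i x * ?d x) x"
      proof (rule sfs.nn_cond_exp_prod)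
        show "?i \<in> borel_measurable (F m)" using band_F[of f k m] by measurable
      qed measurable
      ultimately show ?thesis
        by eventually_elim (simp add: cond_var_def mult.assoc)
    qed
    have "AE x in M. cond_square M F E x \<le> 1 / N"
    proof -
      have "AE x in M. \<forall>m. cond_var E (Suc m) x
          = ennreal (1 / w\<^sup>2) * (indicator (band f k m) x * cond_var f (Suc m) x)"
        using cvSuc by (simp add: AE_all_countable)
      with cv0 show ?thesis
      proof eventually_elim
        case (elim x)
        have "(\<Sum>n. cond_var E n x) = cond_var E 0 x + (\<Sum>m. cond_var E (Suc m) x)"
          using suminf_offset[OF summableI, of "\<lambda>n. cond_var E n x" 1] by simp
        also have "\<dots> = ennreal (1 / w\<^sup>2) * (\<Sum>m. indicator (band f k m) x * cond_var f (Suc m) x)"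
          using elim by simp
        also have "\<dots> \<le> ennreal (1 / w\<^sup>2) * ennreal ((2 powi (k + 1))\<^sup>2)"
          by (intro mult_left_mono band_sum_le) simp
        also have "\<dots> = ennreal ((2 / (3 * tn))\<^sup>2)"
          using w by (simp add: ennreal_mult[symmetric] w_def power_int_add power_divide power_mult_distrib field_simps)
        also have "\<dots> \<le> ennreal ((1 / tn)\<^sup>2)"
          using N by (intro ennreal_leI power_mono) (auto simp: field_simps)
        finally have "\<not> ennreal (1 / tn) < cond_square M F E x"
          using N by (subst less_cond_square_iff) (auto simp: not_less)
        moreover have "ennreal (1 / tn) = 1 / N"
          using N by (simp add: divide_ennreal[symmetric])
        ultimately show ?case by (simp add: not_less)
      qed
    qed
    then have "esssup M (cond_square M F E) \<le> 1 / N"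
      by (intro esssup_I) measurable
    moreover have "AE x in M. enat n \<le> \<tau> k x \<longrightarrow> real_cond_exp M (F n) a x = 0" for n
      using a_cond[of n] by eventually_elim (simp add: h_before)
    ultimately have "atom M F p (\<tau> k) a"
      unfolding atom_def N_def E_def using a_int stop by blast
    moreover have "AE x in M. w * real_cond_exp M (F n) a x = h n x" for n
      using a_cond[of n] by eventually_elim (use w in simp)
    ultimately show ?thesis
      unfolding w_def tn_def N_def h_def by blast
  qed
qed

lemma atomic_decomp_exceed_time:
  assumes mart: "martingale M F f" and f0: "AE x in M. f 0 x = 0"
    and fin: "AE x in M. cond_square M F f x < \<infinity>"
  obtains a where "atomic_decomp M F p f (\<lambda>k. exceed_time f (ennreal ((2 powi k)\<^sup>2))) a"
proof -
  let ?\<tau> = "\<lambda>k :: int. exceed_time f (ennreal ((2 powi k)\<^sup>2))"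
  let ?Q = "\<lambda>k a. atom M F p (?\<tau> k) a \<and> (\<forall>n. AE x in M.
      3 * 2 powi k * enn2real (tau_norm M p (?\<tau> k)) * real_cond_exp M (F n) a x
        = (\<Sum>m<n. indicat_real (band f k m) x * mdiff f (Suc m) x))"
  have "\<forall>k. \<exists>a. ?Q k a"
    by (intro allI exists_band_atom mart)
  from choice[OF this] obtain a where Q: "\<forall>k. ?Q k (a k)" ..
  have a: "atom M F p (?\<tau> k) (a k)" for k
    using Q[rule_format, of k] by (rule conjunct1)
  have sum_a: "AE x in M.
      3 * 2 powi k * enn2real (tau_norm M p (?\<tau> k)) * real_cond_exp M (F n) (a k) x
        = (\<Sum>m<n. indicat_real (band f k m) x * mdiff f (Suc m) x)" for k n
    using Q[rule_format, of k, THEN conjunct2] by (rule spec)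
  have "AE x in M. ((\<lambda>k. 3 * 2 powi k * enn2real (tau_norm M p (?\<tau> k)) * real_cond_exp M (F n) (a k) x)
          has_sum f n x) UNIV" for n
  proof -
    have "AE x in M. \<forall>k. 3 * 2 powi k * enn2real (tau_norm M p (?\<tau> k)) * real_cond_exp M (F n) (a k) x
        = (\<Sum>m<n. indicat_real (band f k m) x * mdiff f (Suc m) x)"
      unfolding AE_all_countable using sum_a by blast
    moreover have "AE x in M. \<forall>m. cond_sum f (Suc m) x = 0 \<longrightarrow> mdiff f (Suc m) x = 0"
      unfolding AE_all_countable using AE_mdiff_eq_0[OF mart] by blast
    ultimately show ?thesis
      using fin f0 AE_space
    proof eventually_elim
      case (elim x)
      have "(\<Sum>n. cond_var f n x) < \<infinity>"
        using elim(3) unfolding cond_square_eq by (simp add: less_top[symmetric])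
      moreover have "cond_sum f m x \<le> (\<Sum>n. cond_var f n x)" for m
        unfolding cond_sum_def by (intro sum_le_suminf summableI) auto
      ultimately have fin: "cond_sum f m x < \<infinity>" for m
        using order_le_less_trans by blast
      have one: "((\<lambda>k. indicat_real (band f k m) x * mdiff f (Suc m) x) has_sum mdiff f (Suc m) x) UNIV" for m
        using elim fin by (intro band_has_sum) auto
      have "((\<lambda>k. \<Sum>m<n. indicat_real (band f k m) x * mdiff f (Suc m) x)
          has_sum (\<Sum>m<n. mdiff f (Suc m) x)) UNIV"
      proof (induction n)
        case (Suc n)
        then show ?case using has_sum_add[OF Suc one[of n]] by simp
      qed simp
      moreover have "(\<Sum>m<n. mdiff f (Suc m) x) = f n x"
        using sum_lessThan_telescope[of "\<lambda>m. f m x" n] elim(4) by (simp add: mdiff_def)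
      ultimately show ?case using elim(1) by simp
    qed
  qed
  with a have "atomic_decomp M F p f ?\<tau> a"
    unfolding atomic_decomp_def by simp
  then show ?thesis by (rule that)
qed

lemma AE_cond_square_finite:
  assumes q: "0 < q" and fin: "Hs_norm M F p q f < \<infinity>"
  shows "AE x in M. cond_square M F f x < \<infinity>"
proof -
  define A where "A = {x \<in> space M. cond_square M F f x = \<infinity>}"
  have A [measurable]: "A \<in> sets M" unfolding A_def by measurable
  let ?v = "\<lambda>k :: int. var_norm_set M p {x \<in> space M. ennreal (2 powi k) < cond_square M F f x}"
  \<comment> \<open>\<open>{s(f) = \<infinity>}\<close> is contained in every level set, and \<open>2\<^sup>k\<close> times their quasi-norms is bounded\<close>
  define D where "D = dyadic_value q ?v"
  obtain C :: real where "0 < C" and C: "\<And>g. dyadic_value q (\<lambda>k. var_norm_set M p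
      {x \<in> space M. ennreal (2 powi k) < g x}) \<le> ennreal C * lorentz_norm M p q g"
    by (rule dyadic_le_lorentz_norm[OF q]) (rule that)
  have "ennreal C * lorentz_norm M p q (cond_square M F f) < \<infinity>"
    using fin unfolding Hs_norm_def by (simp add: ennreal_mult_less_top)
  then have "D < \<infinity>"
    unfolding D_def by (rule order_le_less_trans[OF C])
  then obtain d where d: "D = ennreal d" "0 \<le> d" by (cases D) auto
  have le: "ennreal (2 ^ k) * var_norm_set M p A \<le> ennreal d" for k :: nat
  proof -
    have "var_norm_set M p A \<le> ?v (int k)"
      by (rule var_norm_set_mono) (auto simp: A_def)
    then have "ennreal (2 ^ k) * var_norm_set M p A \<le> ennreal (2 powi int k) * ?v (int k)"
      by (intro mult_mono) auto
    also have "\<dots> \<le> D" unfolding D_def by (rule dyadic_value_ge[OF q])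
    finally show ?thesis using d by simp
  qed
  have "var_norm_set M p A = 0"
  proof -
    obtain n where n: "var_norm_set M p A = ennreal n" "0 \<le> n"
      using var_norm_set_le_1[of A] by (cases "var_norm_set M p A") (auto simp: top_unique)
    have "ennreal (2 ^ k * n) \<le> ennreal d" for k
      using le[of k] n by (simp only: ennreal_mult zero_le_power zero_le_numeral)
    then have "2 ^ k * n \<le> d" for k
      using d by (simp only: ennreal_le_iff)
    then have le: "2 ^ k * n \<le> d" for k by simp
    have "n = 0"
    proof (rule ccontr)
      assume "n \<noteq> 0"
      then have "0 < n" using n by simp
      obtain k where "d / n < 2 ^ k" using real_arch_pow[of 2 "d / n"] by auto
      then have "d < 2 ^ k * n" using \<open>0 < n\<close> by (simp add: field_simps)
      then show False using le[of k] by simp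
    qed
    then show ?thesis using n by simp
  qed
  then have "AE x in M. x \<notin> A" by (rule var_norm_set_eq_0D[OF A])
  then show ?thesis
    using AE_space by eventually_elim (simp add: A_def less_top[symmetric])
qed

end

section \<open>From an atomic decomposition to the square function\<close>

context hardy_setting
begin

lemma stopping_ge_F:
  assumes "ext_stopping_time M F \<tau>"
  shows "{x \<in> space M. enat n \<le> \<tau> x} \<in> sets (F (n - 1))"
proof (cases n)
  case 0
  then show ?thesis
    using sets.top[of "F 0"] by (simp add: zero_enat_def[symmetric])
next
  case (Suc m)
  have "Measurable.pred (F m) (\<lambda>x. \<tau> x \<le> enat m)"
    using stopping_timeD[OF assms[unfolded ext_stopping_time_def], of "enat m"] by simp
  then have "{x \<in> space (F m). \<not> \<tau> x \<le> enat m} \<in> sets (F m)"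
    by measurable
  moreover have "\<not> t \<le> enat m \<longleftrightarrow> enat n \<le> t" for t
    unfolding Suc by (cases t) auto
  ultimately show ?thesis
    unfolding Suc by simp
qed

lemma stopping_finite_M:
  assumes "ext_stopping_time M F \<tau>"
  shows "{x \<in> space M. \<tau> x < \<infinity>} \<in> sets M"
proof -
  have "Measurable.pred (F n) (\<lambda>x. \<tau> x \<le> enat n)" for n
    using stopping_timeD[OF assms[unfolded ext_stopping_time_def], of "enat n"] by simp
  then have "Measurable.pred M (\<lambda>x. \<tau> x \<le> enat n)" for n
    by (rule measurable_F_M)
  then have "{x \<in> space M. \<exists>n. \<tau> x \<le> enat n} \<in> sets M"
    by measurable
  moreover have "t < \<infinity> \<longleftrightarrow> (\<exists>n. t \<le> enat n)" for t
    by (cases t) auto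
  ultimately show ?thesis by (simp only:)
qed

text \<open>The bound holds because, for \<open>k \<ge> j\<close>, the increments of the \<open>k\<close>-th atom up to time \<open>n\<close> vanish on the
  event \<open>B n\<close> where \<open>n \<le> \<tau>\<^sub>k\<close> for all these \<open>k\<close>.  That event belongs to \<open>F\<^bsub>n-1\<^esub>\<close>, so it can be
  pulled out of the conditional expectation.\<close>

lemma cond_square_le_off_atoms:
  assumes dec: "atomic_decomp M F p f \<tau> a" and f_int: "\<And>n. integrable M (f n)"
  shows "AE x in M. (\<forall>k\<ge>j. \<tau> k x = \<infinity>) \<longrightarrow> cond_square M F f x \<le> ennreal (2 powi (j + 2))"
proof -
  have atoms: "atom M F p (\<tau> k) (a k)" for k
    using dec by (simp add: atomic_decomp_def)
  have stop: "ext_stopping_time M F (\<tau> k)" for k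
    using atoms[of k] by (simp add: atom_def)
  define tn where "tn k = enn2real (tau_norm M p (\<tau> k))" for k
  have tn: "tau_norm M p (\<tau> k) = ennreal (tn k)" "0 \<le> tn k" for k
  proof -
    have "tau_norm M p (\<tau> k) \<noteq> \<top>"
      using neq_top_trans[OF _ var_norm_set_le_1] by simp
    then show "tau_norm M p (\<tau> k) = ennreal (tn k)" "0 \<le> tn k"
      by (auto simp: tn_def less_top)
  qed
  define \<mu> where "\<mu> k = 3 * 2 powi k * tn k" for k
  define E where "E k n = real_cond_exp M (F n) (a k)" for k n
  \<comment> \<open>enumerates the indices below \<open>j\<close>, downwards\<close>
  define \<kappa> where "\<kappa> i = j - 1 - int i" for i :: nat
  define c where "c i = ennreal (2 * 2 ^ i * (\<mu> (\<kappa> i))\<^sup>2)" for i :: nat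
  have f_meas [measurable]: "f n \<in> borel_measurable M" for n
    by (rule borel_measurable_integrable[OF f_int])
  have [measurable]: "mdiff f n \<in> borel_measurable M" for n
    by (rule mdiff_measurable) simp
  have [measurable]: "mdiff (E k) n \<in> borel_measurable M" for k n
    by (rule mdiff_measurable) (simp add: E_def)
  have decomp: "AE x in M. \<forall>n. ((\<lambda>k. \<mu> k * E k n x) has_sum f n x) UNIV"
    unfolding AE_all_countable using dec by (simp add: atomic_decomp_def \<mu>_def tn_def E_def)
  have vanish: "AE x in M. \<forall>k n. enat n \<le> \<tau> k x \<longrightarrow> E k n x = 0"
    unfolding AE_all_countable using atoms by (simp add: atom_def E_def)
  define B where "B n = (\<Inter>k\<in>{j..}. {x \<in> space M. enat n \<le> \<tau> k x})" for n
  have B_F: "B n \<in> sets (F (n - 1))" for n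
    unfolding B_def using stopping_ge_F[OF stop] by (intro sets.countable_INT') auto
  have B_M [measurable]: "B n \<in> sets M" for n by (rule sets_F_M[OF B_F])
  have incr: "AE x in M. indicator (B n) x * ennreal (\<bar>mdiff f n x\<bar>\<^sup>2)
      \<le> (\<Sum>i. c i * ennreal (\<bar>mdiff (E (\<kappa> i)) n x\<bar>\<^sup>2))" for n
    using decomp vanish
  proof eventually_elim
    case (elim x)
    show ?case
    proof (cases "x \<in> B n")
      case True
      have dn: "((\<lambda>k. \<mu> k * mdiff (E k) n x) has_sum mdiff f n x) UNIV"
      proof (cases n)
        case 0
        then show ?thesis using elim(1) by (simp add: mdiff_def)
      next
        case (Suc m)
        have "((\<lambda>k. \<mu> k * E k n x + (-1) * (\<mu> k * E k m x)) has_sum (f n x + (-1) * f m x)) UNIV"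
          using elim(1) by (intro has_sum_add has_sum_cmult_right) auto
        then show ?thesis using Suc by (simp add: mdiff_def algebra_simps)
      qed
      have zero: "mdiff (E k) n x = 0" if "j \<le> k" for k
      proof -
        have le: "enat n \<le> \<tau> k x" using True that by (auto simp: B_def)
        have "enat (n - 1) \<le> enat n" by simp
        then have "enat (n - 1) \<le> \<tau> k x" using le by (rule order_trans)
        then have "E k (n - 1) x = 0" using elim(2) by blast
        moreover have "E k n x = 0" using le elim(2) by blast
        ultimately show ?thesis by (cases n) (simp_all add: mdiff_def)
      qed
      have "((\<lambda>k. \<mu> k * mdiff (E k) n x) has_sum mdiff f n x) {..<j}"
        using dn by (subst has_sum_cong_neutral[where T = UNIV]) (auto simp: zero)
      moreover have "bij_betw \<kappa> UNIV {..<j}"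
        unfolding \<kappa>_def by (rule bij_betwI[where g = "\<lambda>k. nat (j - 1 - k)"]) auto
      ultimately have "((\<lambda>i. \<mu> (\<kappa> i) * mdiff (E (\<kappa> i)) n x) has_sum mdiff f n x) UNIV"
        using has_sum_reindex_bij_betw[of \<kappa> UNIV "{..<j}" "\<lambda>k. \<mu> k * mdiff (E k) n x"] by simp
      then have "ennreal ((mdiff f n x)\<^sup>2) \<le> (\<Sum>i. ennreal (2 * 2 ^ i * (\<mu> (\<kappa> i) * mdiff (E (\<kappa> i)) n x)\<^sup>2))"
        by (intro sums_square_le has_sum_imp_sums)
      also have "\<dots> = (\<Sum>i. c i * ennreal (\<bar>mdiff (E (\<kappa> i)) n x\<bar>\<^sup>2))"
        unfolding c_def
        by (intro suminf_cong, subst ennreal_mult[symmetric]) (auto simp: power_mult_distrib mult.assoc)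
      finally show ?thesis using True by simp
    qed simp
  qed
  have cv: "AE x in M. indicator (B n) x * cond_var f n x \<le> (\<Sum>i. c i * cond_var (E (\<kappa> i)) n x)" for n
  proof -
    let ?F = "F (n - 1)"
    let ?d = "\<lambda>x. ennreal (\<bar>mdiff f n x\<bar>\<^sup>2)"
    let ?e = "\<lambda>i x. ennreal (\<bar>mdiff (E (\<kappa> i)) n x\<bar>\<^sup>2)"
    have "AE x in M. indicator (B n) x * nn_cond_exp M ?F ?d x = nn_cond_exp M ?F (\<lambda>x. indicator (B n) x * ?d x) x"
      using B_F[of n] by (intro sfs.nn_cond_exp_prod) auto
    moreover have "AE x in M. nn_cond_exp M ?F (\<lambda>x. indicator (B n) x * ?d x) x
        \<le> nn_cond_exp M ?F (\<lambda>x. \<Sum>i. c i * ?e i x) x"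
      by (rule sfs.nn_cond_exp_mono[OF incr]) measurable
    moreover have "AE x in M. (\<Sum>i. nn_cond_exp M ?F (\<lambda>x. c i * ?e i x) x) = nn_cond_exp M ?F (\<lambda>x. \<Sum>i. c i * ?e i x) x"
      by (rule sfs.nn_cond_exp_suminf) measurable
    moreover have "AE x in M. \<forall>i. c i * nn_cond_exp M ?F (?e i) x = nn_cond_exp M ?F (\<lambda>x. c i * ?e i x) x"
      unfolding AE_all_countable by (intro allI sfs.nn_cond_exp_prod) measurable
    ultimately show ?thesis
      unfolding cond_var_def by eventually_elim simp
  qed
  have atom_bound: "AE x in M. c i * (\<Sum>n. cond_var (E (\<kappa> i)) n x) \<le> ennreal (18 * (2 powi (j - 1))\<^sup>2 * (1 / 2) ^ i)" for i
  proof (cases "tn (\<kappa> i) = 0")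
    case True
    then show ?thesis by (simp add: c_def \<mu>_def)
  next
    case False
    let ?t = "tn (\<kappa> i)"
    have t0: "0 < ?t" using False tn(2)[of "\<kappa> i"] by simp
    have "esssup M (cond_square M F (E (\<kappa> i))) \<le> 1 / tau_norm M p (\<tau> (\<kappa> i))"
      using atoms[of "\<kappa> i"] unfolding atom_def E_def by blast
    also have "\<dots> = ennreal (1 / ?t)"
      unfolding tn(1) using t0 by (simp add: divide_ennreal[symmetric])
    finally have le: "esssup M (cond_square M F (E (\<kappa> i))) \<le> ennreal (1 / ?t)" .
    show ?thesis
      using esssup_AE[of "cond_square M F (E (\<kappa> i))" M]
    proof eventually_elim
      case (elim x)
      then have "\<not> ennreal (1 / ?t) < cond_square M F (E (\<kappa> i)) x"
        using le by (meson leD order_trans)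
      then have "(\<Sum>n. cond_var (E (\<kappa> i)) n x) \<le> ennreal ((1 / ?t)\<^sup>2)"
        using t0 by (subst (asm) less_cond_square_iff) (auto simp: not_less)
      then have "c i * (\<Sum>n. cond_var (E (\<kappa> i)) n x) \<le> c i * ennreal ((1 / ?t)\<^sup>2)"
        by (rule mult_left_mono) simp
      also have "\<dots> = ennreal (2 * 2 ^ i * (\<mu> (\<kappa> i))\<^sup>2 * (1 / ?t)\<^sup>2)"
        unfolding c_def by (rule ennreal_mult[symmetric]) auto
      also have "2 * 2 ^ i * (\<mu> (\<kappa> i))\<^sup>2 * (1 / ?t)\<^sup>2 = 18 * (2 powi (j - 1))\<^sup>2 * (1 / 2) ^ i"
      proof -
        have "\<mu> (\<kappa> i) * (1 / ?t) = 3 * 2 powi (j - 1) * (1 / 2) ^ i"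
          using t0 by (simp add: \<mu>_def \<kappa>_def power_int_diff power_divide)
        then have "(\<mu> (\<kappa> i))\<^sup>2 * (1 / ?t)\<^sup>2 = (3 * 2 powi (j - 1) * (1 / 2) ^ i)\<^sup>2"
          unfolding power_mult_distrib[symmetric] by simp
        moreover have "(2::real) ^ i * (1 / 2) ^ i = 1"
          unfolding power_mult_distrib[symmetric] by simp
        then have "2 * 2 ^ i * (3 * y * (1 / 2) ^ i)\<^sup>2 = 18 * y\<^sup>2 * (1 / 2) ^ i" for y :: real
          unfolding power2_eq_square by (simp add: field_simps)
        ultimately show ?thesis by (simp only: mult.assoc)
      qed
      finally show ?case .
    qed
  qed
  have cv_all: "AE x in M. \<forall>n. indicator (B n) x * cond_var f n x \<le> (\<Sum>i. c i * cond_var (E (\<kappa> i)) n x)"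
    unfolding AE_all_countable using cv by blast
  have bound_all: "AE x in M. \<forall>i. c i * (\<Sum>n. cond_var (E (\<kappa> i)) n x) \<le> ennreal (18 * (2 powi (j - 1))\<^sup>2 * (1 / 2) ^ i)"
    unfolding AE_all_countable using atom_bound by blast
  show ?thesis
    using cv_all bound_all AE_space
  proof eventually_elim
    case (elim x)
    show ?case
    proof
      assume inf: "\<forall>k\<ge>j. \<tau> k x = \<infinity>"
      then have xB: "x \<in> B n" for n using elim(3) by (simp add: B_def)
      have "(\<Sum>n. cond_var f n x) \<le> (\<Sum>n. \<Sum>i. c i * cond_var (E (\<kappa> i)) n x)"
      proof (rule suminf_le[OF _ summableI summableI])
        show "cond_var f n x \<le> (\<Sum>i. c i * cond_var (E (\<kappa> i)) n x)" for n
          using elim(1)[rule_format, of n] xB[of n] by simp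
      qed
      also have "\<dots> = (\<Sum>i. c i * (\<Sum>n. cond_var (E (\<kappa> i)) n x))"
        by (subst suminf_ennreal_swap) simp
      also have "\<dots> \<le> (\<Sum>i. ennreal (18 * (2 powi (j - 1))\<^sup>2 * (1 / 2) ^ i))"
        using elim(2) by (intro suminf_le summableI) blast
      also have "\<dots> = ennreal (18 * (2 powi (j - 1))\<^sup>2 * (1 / (1 - 1 / 2)))"
        by (intro suminf_ennreal_eq sums_mult geometric_sums) auto
      also have "\<dots> \<le> ennreal ((2 powi (j + 2))\<^sup>2)"
        by (intro ennreal_leI) (simp add: power_int_add power_int_diff power_mult_distrib power_divide)
      finally have "\<not> ennreal (2 powi (j + 2)) < cond_square M F f x"
        by (subst less_cond_square_iff) (auto simp: not_less)
      then show "cond_square M F f x \<le> ennreal (2 powi (j + 2))" by (simp add: not_less)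
    qed
  qed
qed

lemma Hs_norm_le_dyadic_norm:
  assumes q: "0 < q"
  obtains C :: real where "0 < C"
    "\<And>f \<tau> a. martingale M F f \<Longrightarrow> atomic_decomp M F p f \<tau> a \<Longrightarrow>
      Hs_norm M F p q f \<le> ennreal C * dyadic_norm M p q \<tau>"
proof -
  obtain K :: real where K: "1 \<le> K" and UN: "\<And>A :: nat \<Rightarrow> 'a set. (\<And>i. A i \<in> sets M) \<Longrightarrow>
      var_norm_set M p (\<Union>i. A i) \<le> ennreal K * (SUP i. ennreal ((3/2) ^ i) * var_norm_set M p (A i))"
    by (rule var_norm_set_UN) (rule that; blast)
  obtain C :: real where C: "0 < C" and
    le: "\<And>g v. (\<And>j. var_norm_set M p {x \<in> space M. ennreal (2 powi (j + 2)) < g x}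
          \<le> ennreal K * (SUP i. ennreal ((3/2) ^ i) * v (j + int i)))
       \<Longrightarrow> lorentz_norm M p q g \<le> ennreal C * dyadic_value q v"
    by (rule lorentz_norm_le_dyadic[OF q K]) (rule that; blast)
  have "Hs_norm M F p q f \<le> ennreal C * dyadic_norm M p q \<tau>"
    if mart: "martingale M F f" and dec: "atomic_decomp M F p f \<tau> a" for f \<tau> a
    unfolding Hs_norm_def dyadic_norm_eq
  proof (rule le)
    fix j :: int
    define A where "A i = {x \<in> space M. \<tau> (j + int i) x < \<infinity>}" for i :: nat
    have A: "A i \<in> sets M" for i
      unfolding A_def using dec by (intro stopping_finite_M) (simp add: atomic_decomp_def atom_def)
    have "AE x in M. x \<in> {x \<in> space M. ennreal (2 powi (j + 2)) < cond_square M F f x} \<longrightarrow> x \<in> (\<Union>i. A i)"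
    proof -
      have "AE x in M. (\<forall>k\<ge>j. \<tau> k x = \<infinity>) \<longrightarrow> cond_square M F f x \<le> ennreal (2 powi (j + 2))"
        by (rule cond_square_le_off_atoms[OF dec]) (use mart in \<open>simp add: martingale_def\<close>)
      then show ?thesis
      proof eventually_elim
        case (elim x)
        show ?case
        proof
          assume x: "x \<in> {x \<in> space M. ennreal (2 powi (j + 2)) < cond_square M F f x}"
          then have "\<not> (\<forall>k\<ge>j. \<tau> k x = \<infinity>)" using elim by (auto dest: leD)
          then obtain k where "j \<le> k" "\<tau> k x \<noteq> \<infinity>" by blast
          then have "x \<in> A (nat (k - j))" using x by (auto simp: A_def)
          then show "x \<in> (\<Union>i. A i)" by blast
        qed
      qed
    qed
    then have "var_norm_set M p {x \<in> space M. ennreal (2 powi (j + 2)) < cond_square M F f x}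
        \<le> var_norm_set M p (\<Union>i. A i)"
      by (rule var_norm_set_mono_AE)
    also have "\<dots> \<le> ennreal K * (SUP i. ennreal ((3/2) ^ i) * var_norm_set M p (A i))"
      by (rule UN[OF A])
    finally show "var_norm_set M p {x \<in> space M. ennreal (2 powi (j + 2)) < cond_square M F f x}
        \<le> ennreal K * (SUP i. ennreal ((3/2) ^ i) * tau_norm M p (\<tau> (j + int i)))"
      by (simp only: A_def)
  qed
  with C show ?thesis by (rule that)
qed

lemma exists_decomp_dyadic_norm_le:
  assumes q: "0 < q"
  obtains C :: real where "0 < C"
    "\<And>f. martingale M F f \<Longrightarrow> AE x in M. f 0 x = 0 \<Longrightarrow> Hs_norm M F p q f < \<infinity> \<Longrightarrow>
      \<exists>\<tau> a. atomic_decomp M F p f \<tau> a \<and> dyadic_norm M p q \<tau> \<le> ennreal C * Hs_norm M F p q f"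
proof -
  obtain C :: real where C: "0 < C" and le: "\<And>g. dyadic_value q (\<lambda>k. var_norm_set M p
      {x \<in> space M. ennreal (2 powi k) < g x}) \<le> ennreal C * lorentz_norm M p q g"
    by (rule dyadic_le_lorentz_norm[OF q]) (rule that)
  have "\<exists>\<tau> a. atomic_decomp M F p f \<tau> a \<and> dyadic_norm M p q \<tau> \<le> ennreal C * Hs_norm M F p q f"
    if mart: "martingale M F f" and f0: "AE x in M. f 0 x = 0" and fin: "Hs_norm M F p q f < \<infinity>" for f
  proof -
    let ?\<tau> = "\<lambda>k :: int. exceed_time f (ennreal ((2 powi k)\<^sup>2))"
    obtain a where "atomic_decomp M F p f ?\<tau> a"
      using atomic_decomp_exceed_time[OF mart f0 AE_cond_square_finite[OF q fin]] .
    moreover have "dyadic_norm M p q ?\<tau> \<le> ennreal C * Hs_norm M F p q f"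
      unfolding dyadic_norm_eq tau_norm_exceed_time Hs_norm_def by (rule le)
    ultimately show ?thesis by blast
  qed
  with C show ?thesis by (rule that)
qed

end

section \<open>The atomic characterisation\<close>

theorem theorem3p9:
  fixes M :: "'a measure" and F :: "nat \<Rightarrow> 'a measure"
    and p :: "'a \<Rightarrow> real" and q :: ennreal
  assumes "prob_space M" and "complete_measure M"
    and "\<And>n. subalgebra M (F n)" and "filtration (space M) F"
    and "sets M = sigma_sets (space M) (\<Union>n. sets (F n))"
    and "p \<in> borel_measurable M" and "\<And>x. x \<in> space M \<Longrightarrow> 0 < p x"
    and "0 < essinf M (\<lambda>x. ereal (p x))" and "esssup M (\<lambda>x. ereal (p x)) < \<infinity>"
    and "0 < q"
  shows "{f \<in> Hs M F p q. AE x in M. f 0 x = 0} = Hat M F p q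
    \<and> (\<exists>c C::real. 0 < c \<and> 0 < C \<and>
         (\<forall>f \<in> Hat M F p q.
            ennreal c * Hs_norm M F p q f \<le> Hat_norm M F p q f
            \<and> Hat_norm M F p q f \<le> ennreal C * Hs_norm M F p q f))"
proof -
  obtain \<delta> where \<delta>: "0 < ereal \<delta>" "ereal \<delta> < essinf M (\<lambda>x. ereal (p x))"
    using ereal_dense2[OF assms(8)] by blast
  have ae: "AE x in M. \<delta> \<le> p x"
    using less_LiminfD[OF \<delta>(2)[unfolded essinf_def]] by eventually_elim simp
  interpret prob_space M by (rule assms(1))
  interpret hardy_setting M F p \<delta>
  proof
    show "subalgebra M (F n)" for n by (rule assms(3))
    show "sets (F m) \<subseteq> sets (F n)" if "m \<le> n" for m n
      using assms(4) that by (simp add: filtration_def)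
    show "p \<in> borel_measurable M" by (rule assms(6))
    show "0 < \<delta>" using \<delta>(1) by simp
    show "AE x in M. \<delta> \<le> p x" by (rule ae)
  qed
  obtain C1 :: real where C1: "0 < C1" and Hs_le: "\<And>f \<tau> a. martingale M F f \<Longrightarrow> atomic_decomp M F p f \<tau> a \<Longrightarrow>
      Hs_norm M F p q f \<le> ennreal C1 * dyadic_norm M p q \<tau>"
    by (rule Hs_norm_le_dyadic_norm[OF assms(10)]) (rule that)
  obtain C2 :: real where C2: "0 < C2" and dec: "\<And>f. martingale M F f \<Longrightarrow> AE x in M. f 0 x = 0 \<Longrightarrow>
      Hs_norm M F p q f < \<infinity> \<Longrightarrow>
      \<exists>\<tau> a. atomic_decomp M F p f \<tau> a \<and> dyadic_norm M p q \<tau> \<le> ennreal C2 * Hs_norm M F p q f"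
    by (rule exists_decomp_dyadic_norm_le[OF assms(10)]) (rule that)
  have Hat_le: "Hat_norm M F p q f \<le> ennreal C2 * Hs_norm M F p q f"
    if f: "martingale M F f" "AE x in M. f 0 x = 0" "Hs_norm M F p q f < \<infinity>" for f
  proof -
    obtain \<tau> a where *: "atomic_decomp M F p f \<tau> a" "dyadic_norm M p q \<tau> \<le> ennreal C2 * Hs_norm M F p q f"
      using dec[OF f] by blast
    have "Hat_norm M F p q f \<le> dyadic_norm M p q \<tau>"
      unfolding Hat_norm_def using *(1) by (intro Inf_lower) blast
    then show ?thesis using *(2) by (rule order_trans)
  qed
  have Hat_Hs: "f \<in> Hs M F p q" if f: "f \<in> Hat M F p q" for f
  proof -
    have mart: "martingale M F f" using f by (simp add: Hat_def)
    have "Inf {dyadic_norm M p q \<tau> |\<tau> a. atomic_decomp M F p f \<tau> a} < \<infinity>"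
      using f by (simp add: Hat_def Hat_norm_def)
    then obtain \<tau> a where *: "atomic_decomp M F p f \<tau> a" "dyadic_norm M p q \<tau> < \<infinity>"
      unfolding Inf_less_iff by blast
    have "ennreal C1 * dyadic_norm M p q \<tau> < \<infinity>"
      using *(2) by (simp add: ennreal_mult_less_top)
    with Hs_le[OF mart *(1)] have "Hs_norm M F p q f < \<infinity>" by (rule order_le_less_trans)
    then show ?thesis using mart by (simp add: Hs_def)
  qed
  have eq: "{f \<in> Hs M F p q. AE x in M. f 0 x = 0} = Hat M F p q"
  proof (intro set_eqI iffI)
    fix f assume "f \<in> {f \<in> Hs M F p q. AE x in M. f 0 x = 0}"
    then have f: "martingale M F f" "AE x in M. f 0 x = 0" "Hs_norm M F p q f < \<infinity>"
      by (simp_all add: Hs_def)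
    have "ennreal C2 * Hs_norm M F p q f < \<infinity>"
      using f(3) by (simp add: ennreal_mult_less_top)
    with Hat_le[OF f] have "Hat_norm M F p q f < \<infinity>" by (rule order_le_less_trans)
    then show "f \<in> Hat M F p q"
      using f(1) dec[OF f] unfolding Hat_def by blast
  next
    fix f assume "f \<in> Hat M F p q"
    then show "f \<in> {f \<in> Hs M F p q. AE x in M. f 0 x = 0}"
      using Hat_Hs Hat_start_zero[of f M F p q] by simp
  qed
  have "ennreal (1 / C1) * Hs_norm M F p q f \<le> Hat_norm M F p q f
      \<and> Hat_norm M F p q f \<le> ennreal C2 * Hs_norm M F p q f" if f: "f \<in> Hat M F p q" for f
  proof
    have "f \<in> {f \<in> Hs M F p q. AE x in M. f 0 x = 0}" using f eq by simp
    then have f': "martingale M F f" "AE x in M. f 0 x = 0" "Hs_norm M F p q f < \<infinity>"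
      by (simp_all add: Hs_def)
    then show "Hat_norm M F p q f \<le> ennreal C2 * Hs_norm M F p q f" by (rule Hat_le)
    show "ennreal (1 / C1) * Hs_norm M F p q f \<le> Hat_norm M F p q f"
      unfolding Hat_norm_def
    proof (rule Inf_greatest)
      fix y assume "y \<in> {dyadic_norm M p q \<tau> |\<tau> a. atomic_decomp M F p f \<tau> a}"
      then obtain \<tau> a where y: "y = dyadic_norm M p q \<tau>" and d: "atomic_decomp M F p f \<tau> a" by blast
      have "ennreal (1 / C1) * Hs_norm M F p q f \<le> ennreal (1 / C1) * (ennreal C1 * y)"
        unfolding y by (intro mult_left_mono Hs_le[OF f'(1) d]) simp
      also have "\<dots> = (ennreal (1 / C1) * ennreal C1) * y"
        by (simp only: mult.assoc)
      also have "ennreal (1 / C1) * ennreal C1 = 1"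
        using C1 by (subst ennreal_mult[symmetric]) auto
      finally show "ennreal (1 / C1) * Hs_norm M F p q f \<le> y" by simp
    qed
  qed
  then have "\<exists>c C::real. 0 < c \<and> 0 < C \<and>
         (\<forall>f \<in> Hat M F p q.
            ennreal c * Hs_norm M F p q f \<le> Hat_norm M F p q f
            \<and> Hat_norm M F p q f \<le> ennreal C * Hs_norm M F p q f)"
    using C1 C2 by (intro exI[of _ "1 / C1"] exI[of _ C2]) simp
  with eq show ?thesis ..
qed

end
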